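(* Let $\beta\in(0,1)$ and let $\Lambda=\{\lambda_n\}\subset\mathbb{D}\setminus\{0\}$ be such that $$\sum_{\lambda\in\Lambda}\frac{1}{\log^{\beta}\frac{1}{1-|\lambda|}}<\infty .$$ For $\alpha>0$ and $\lambda=(1-\delta_\lambda)e^{i\theta_\lambda}\in\mathbb{D}\setminus\{0\}$ with $\delta_\lambda=1-|\lambda|$, let $$\mathcal{S}_{\lambda,\alpha}=\Bigl\{z\in\mathbb{D}:\ |z-e^{i\theta_\lambda}|<\delta_\lambda\log^{\alpha}\frac1{\delta_\lambda}\Bigr\}.$$ Let $\alpha>0$, $\gamma\in(0,1-\beta)$, let $\Delta_\lambda\subset\mathcal{S}_{\lambda,\alpha}$ for $\lambda\in\Lambda$, and let $\mathcal{Z}$ be a subset of $\bigcup_{\lambda\in\Lambda}\Delta_\lambda$ such that $$\sum_{\lambda\in\Lambda}\#(\mathcal{Z}\cap\Delta_\lambda)\,e^{-\log^{\gamma}\frac{1}{1-|\lambda|}}<\infty .$$ Then $\mathcal{Z}$ is a zero set of the Dirichlet space $\mathcal{D}$.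
   Context: $\mathbb{D}$ is the open unit disk. The Dirichlet space $\mathcal{D}$ is the space of analytic functions $f$ on $\mathbb{D}$ with $\int_{\mathbb{D}}|f'|^2\,dA<\infty$, where $dA$ is normalized area measure. A set $\mathcal{Z}\subset\mathbb{D}$ is a zero set of $\mathcal{D}$ if there is $f\in\mathcal{D}$, $f\not\equiv0$, vanishing on $\mathcal{Z}$. Here $\log^{\gamma}x=(\log x)^{\gamma}$, and $\#$ denotes cardinality. *)

theory Defs
  imports "HOL-Complex_Analysis.Complex_Analysis"
begin

text \<open>The uniform measure on the disk is Lebesgue measure restricted to the disk and
  divided by its area.\<close>

definition disk_area_measure :: "complex measure" where
  "disk_area_measure = uniform_measure lborel (ball 0 1)"

text \<open>Elements are total functions \<open>complex \<Rightarrow> complex\<close>; their values outside the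
  disk are irrelevant.\<close>

definition dirichlet_space :: "(complex \<Rightarrow> complex) set" where
  "dirichlet_space =
     {f. f holomorphic_on ball 0 1 \<and>
         (\<integral>\<^sup>+ z. ennreal ((cmod (deriv f z))\<^sup>2) \<partial>disk_area_measure) < \<infinity>}"

definition dirichlet_zero_set :: "complex set \<Rightarrow> bool" where
  "dirichlet_zero_set Z \<longleftrightarrow>
     Z \<subseteq> ball 0 1 \<and>
     (\<exists>f \<in> dirichlet_space. (\<exists>z \<in> ball 0 1. f z \<noteq> 0) \<and> (\<forall>z \<in> Z. f z = 0))"

text \<open>Intended for \<open>0 < cmod l < 1\<close>, where \<open>l = (1 - d) * cis (Arg l)\<close> with
  \<open>d = 1 - cmod l\<close>.\<close>

definition S_region :: "complex \<Rightarrow> real \<Rightarrow> complex set" where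
  "S_region l \<alpha> =
     {z \<in> ball 0 1.
        cmod (z - cis (Arg l)) < (1 - cmod l) * (ln (1 / (1 - cmod l))) powr \<alpha>}"

end

theory Submission
  imports Defs "HOL-Real_Asymp.Real_Asymp"
begin

text \<open>Put \<open>s = \<beta> + \<gamma> < 1\<close> and \<open>\<zeta> = cis (Arg l)\<close> for \<open>l \<in> \<Lambda>\<close>. With weights \<open>c l\<close> proportional to
  \<open>ln (1 / (1 - cmod l)) powr (-\<beta>)\<close>, which are summable, the function
  \<open>F = exp (- (\<Sum>l. c l * (ln (4 / (1 - cnj \<zeta> * z))) powr s))\<close> has Dirichlet integral at most a multiple of
  \<open>\<Sum>l. c l\<close>, and \<open>(cmod F)\<^sup>2 \<le> exp (- (ln (1 / (1 - cmod l)) powr \<gamma>))\<close> within distance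
  \<open>(1 - cmod l) powr (1/4)\<close> of \<open>\<zeta>\<close>. Hence the Poisson integral of \<open>(cmod F)\<^sup>2\<close> at a point of
  \<open>S_region l \<alpha>\<close> is at most a multiple of \<open>exp (- (ln (1 / (1 - cmod l)) powr \<gamma>))\<close>. By Carleson's formula
  these Poisson integrals, summed over the zeros, are what multiplication by a Blaschke product
  adds to the Dirichlet integral of \<open>F\<close>. Uniform bounds for finite subfamilies of \<open>\<Lambda>\<close>
  suffice, since Montel's theorem and Fatou's lemma then give the function vanishing on \<open>Z\<close>.\<close>

section \<open>Multiplication by Blaschke factors\<close>

text \<open>The zeros may come arbitrarily close to the circle inside their regions, so what must be
  small at them is an average of \<open>(cmod F)\<^sup>2\<close> against the Poisson kernel, not a
  value of F. Put \<delta> = 1 - cmod l. At distance \<rho> the kernel is of order (1 - |a|^2) /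
  \<rho>^2. For \<rho> = \<delta>^(1/4) the region of radius \<delta> log^\<alpha>(1/\<delta>) lies
  well inside the disc of radius \<rho>, and the tail is of order \<delta>^(1/2)
  log^\<alpha>(1/\<delta>), which is below exp(-log^\<gamma>(1/\<delta>)) for small \<delta> because
  \<gamma> < 1. Any exponent strictly between 0 and 1/2 would do in place of 1/4. The exponent s
  comes from c * x^s = x^\<gamma> with c of size x^(-\<beta>), and \<gamma> < 1 - \<beta> says
  exactly that s < 1. For s \<ge> 1/2 a single term of the sum in the exponent already has infinite
  Dirichlet integral: its squared derivative behaves like log^(2s-2)(1/u) / u^2 at distance u from
  \<zeta>. Only the decay of F lowers the power to log^(s-2), which is integrable for every s <
  1.\<close>

definition hardy_partial :: "complex fps \<Rightarrow> nat \<Rightarrow> real" where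
  "hardy_partial f N = (\<Sum>n\<le>N. (cmod (fps_nth f n))\<^sup>2)"

definition dirichlet_partial :: "complex fps \<Rightarrow> nat \<Rightarrow> real" where
  "dirichlet_partial f N = (\<Sum>n\<le>N. real n * (cmod (fps_nth f n))\<^sup>2)"

text \<open>The Taylor series at 0 of (z - a) / (1 - cnj a * z). It carries no unimodular
  normalisation, since only finite products are formed, and \<open>a = 0\<close> is no special
  case.\<close>

definition blaschke_fps :: "complex \<Rightarrow> complex fps" where
  "blaschke_fps a = (fps_X - fps_const a) * inverse (1 - fps_const (cnj a) * fps_X)"

text \<open>Coefficient form of the fact that w - a and 1 - cnj a * w have equal modulus on the unit
  circle. If x and y are the coefficients of h at n and n + 1, the left side compares the
  coefficients at n + 1 of h times each factor. With \<open>y = 1\<close> it is the usual identity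
  inside the disk.\<close>

lemma cmod_diff_blaschke_coeffs:
  "(cmod (x - a * y))\<^sup>2 - (cmod (y - cnj a * x))\<^sup>2
     = (1 - (cmod a)\<^sup>2) * ((cmod x)\<^sup>2 - (cmod y)\<^sup>2)"
  unfolding cmod_power2 by (simp add: power2_eq_square) algebra

text \<open>The differences of squared coefficients telescope; truncation leaves one boundary term,
  of favourable sign when \<open>cmod a \<le> 1\<close>.\<close>

lemma hardy_partial_linear_factor:
  "hardy_partial ((fps_X - fps_const a) * h) N
     = hardy_partial ((1 - fps_const (cnj a) * fps_X) * h) N
       - (1 - (cmod a)\<^sup>2) * (cmod (fps_nth h N))\<^sup>2"
proof (induction N)
  case 0
  then show ?case
    by (simp add: hardy_partial_def norm_mult power_mult_distrib algebra_simps)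
next
  case (Suc N)
  have "(cmod (fps_nth ((fps_X - fps_const a) * h) (Suc N)))\<^sup>2
      - (cmod (fps_nth ((1 - fps_const (cnj a) * fps_X) * h) (Suc N)))\<^sup>2
      = (1 - (cmod a)\<^sup>2) * ((cmod (fps_nth h N))\<^sup>2 - (cmod (fps_nth h (Suc N)))\<^sup>2)"
    using cmod_diff_blaschke_coeffs[of "fps_nth h N" a "fps_nth h (Suc N)"]
    by (simp add: algebra_simps)
  with Suc.IH show ?case
    unfolding hardy_partial_def sum.atMost_Suc by (simp add: algebra_simps)
qed

text \<open>Summation by parts: the weight n turns the telescoping differences into the whole sum
  \<open>hardy_partial h N\<close>, the source of the Poisson integral. The boundary term is
  negative again and can be discarded.\<close>

lemma dirichlet_partial_linear_factor:
  "dirichlet_partial ((fps_X - fps_const a) * h) N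
     = dirichlet_partial ((1 - fps_const (cnj a) * fps_X) * h) N
       + (1 - (cmod a)\<^sup>2) * (hardy_partial h N - real (N + 1) * (cmod (fps_nth h N))\<^sup>2)"
proof (induction N)
  case 0
  then show ?case by (simp add: dirichlet_partial_def hardy_partial_def)
next
  case (Suc N)
  have *: "(cmod (fps_nth ((fps_X - fps_const a) * h) (Suc N)))\<^sup>2
      = (cmod (fps_nth ((1 - fps_const (cnj a) * fps_X) * h) (Suc N)))\<^sup>2
      + (1 - (cmod a)\<^sup>2) * ((cmod (fps_nth h N))\<^sup>2 - (cmod (fps_nth h (Suc N)))\<^sup>2)"
    using cmod_diff_blaschke_coeffs[of "fps_nth h N" a "fps_nth h (Suc N)"]
    by (simp add: algebra_simps)
  show ?case
    using Suc.IH unfolding dirichlet_partial_def hardy_partial_def sum.atMost_Suc *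
    by (simp add: algebra_simps)
qed

lemma linear_factor_inverse_fps:
  "(1 - fps_const a * fps_X) * (g * inverse (1 - fps_const a * fps_X :: complex fps)) = g"
proof -
  have "inverse (1 - fps_const a * fps_X) * (1 - fps_const a * fps_X :: complex fps) = 1"
    by (rule inverse_mult_eq_1) simp
  thus ?thesis by (metis mult.commute mult.left_commute mult_1)
qed

lemma hardy_partial_blaschke_le:
  assumes "cmod a < 1"
  shows "hardy_partial (g * blaschke_fps a) N \<le> hardy_partial g N"
proof -
  define h where "h = g * inverse (1 - fps_const (cnj a) * fps_X)"
  have "g * blaschke_fps a = (fps_X - fps_const a) * h"
    by (simp add: h_def blaschke_fps_def mult_ac)
  moreover have "(1 - fps_const (cnj a) * fps_X) * h = g"
    unfolding h_def by (rule linear_factor_inverse_fps)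
  moreover have "(cmod a)\<^sup>2 \<le> 1" using assms by (simp add: power_le_one)
  ultimately show ?thesis
    using hardy_partial_linear_factor[of a h N] by simp
qed

lemma hardy_partial_blaschke_prod_le:
  assumes "finite A" "\<And>a. a \<in> A \<Longrightarrow> cmod a < 1"
  shows "hardy_partial (g * (\<Prod>a\<in>A. blaschke_fps a)) N \<le> hardy_partial g N"
  using assms
proof (induction A)
  case (insert a A)
  have "hardy_partial ((g * (\<Prod>a\<in>A. blaschke_fps a)) * blaschke_fps a) N
     \<le> hardy_partial (g * (\<Prod>a\<in>A. blaschke_fps a)) N"
    using insert.prems by (intro hardy_partial_blaschke_le) auto
  also have "\<dots> \<le> hardy_partial g N" using insert by auto
  finally show ?case using insert.hyps by (simp add: mult_ac)
qed simp

text \<open>On the unit circle (1 - |a|^2) / |1 - cnj a * w|^2 is the Poisson kernel at a. By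
  Parseval the added term is therefore a truncation of the Poisson integral at a of |g|^2, for g in
  the Hardy space.\<close>

lemma dirichlet_partial_blaschke_le:
  assumes "cmod a < 1"
  shows "dirichlet_partial (g * blaschke_fps a) N
     \<le> dirichlet_partial g N
        + (1 - (cmod a)\<^sup>2) * hardy_partial (g * inverse (1 - fps_const (cnj a) * fps_X)) N"
proof -
  define h where "h = g * inverse (1 - fps_const (cnj a) * fps_X)"
  have 1: "g * blaschke_fps a = (fps_X - fps_const a) * h"
    by (simp add: h_def blaschke_fps_def mult_ac)
  have 2: "(1 - fps_const (cnj a) * fps_X) * h = g"
    unfolding h_def by (rule linear_factor_inverse_fps)
  have 3: "(cmod a)\<^sup>2 \<le> 1" using assms by (simp add: power_le_one)
  have "(1 - (cmod a)\<^sup>2) * (hardy_partial h N - real (N + 1) * (cmod (fps_nth h N))\<^sup>2)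
     \<le> (1 - (cmod a)\<^sup>2) * hardy_partial h N"
    using 3 by (intro mult_left_mono) auto
  with dirichlet_partial_linear_factor[of a h N] show ?thesis
    unfolding 1 2 h_def[symmetric] by linarith
qed

text \<open>A coefficient form of Carleson's formula for the Dirichlet integral of a finite Blaschke
  product times \<open>g\<close>; working with partial sums avoids boundary values.\<close>

lemma dirichlet_partial_blaschke_prod_le:
  assumes "finite A" "\<And>a. a \<in> A \<Longrightarrow> cmod a < 1"
  shows "dirichlet_partial (g * (\<Prod>a\<in>A. blaschke_fps a)) N
     \<le> dirichlet_partial g N
        + (\<Sum>a\<in>A. (1 - (cmod a)\<^sup>2)
             * hardy_partial (g * inverse (1 - fps_const (cnj a) * fps_X)) N)"
  using assms
proof (induction A)
  case (insert a A)
  define I :: "complex fps" where "I = inverse (1 - fps_const (cnj a) * fps_X)"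
  define P where "P = (\<Prod>a\<in>A. blaschke_fps a)"
  have "dirichlet_partial ((g * P) * blaschke_fps a) N
     \<le> dirichlet_partial (g * P) N + (1 - (cmod a)\<^sup>2) * hardy_partial ((g * P) * I) N"
    using insert.prems unfolding I_def by (intro dirichlet_partial_blaschke_le) auto
  \<comment> \<open>The factors multiplied in earlier are removed by contractivity, so each zero is
    charged with \<open>g\<close> alone and the cost is additive over \<open>A\<close>.\<close>
  moreover have "hardy_partial ((g * P) * I) N \<le> hardy_partial (g * I) N"
    using hardy_partial_blaschke_prod_le[of A "g * I" N] insert by (simp add: P_def mult_ac)
  hence "(1 - (cmod a)\<^sup>2) * hardy_partial ((g * P) * I) N
     \<le> (1 - (cmod a)\<^sup>2) * hardy_partial (g * I) N"
    using insert.prems by (intro mult_left_mono) (auto simp: power_le_one less_imp_le)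
  moreover have "dirichlet_partial (g * P) N \<le> dirichlet_partial g N
      + (\<Sum>a\<in>A. (1 - (cmod a)\<^sup>2)
             * hardy_partial (g * inverse (1 - fps_const (cnj a) * fps_X)) N)"
    unfolding P_def using insert by auto
  ultimately show ?case using insert.hyps by (simp add: P_def I_def mult_ac)
qed simp

section \<open>Parseval's identity on circles and on the disk\<close>

lemma has_integral_cis_int:
  "((\<lambda>t. cis (of_int k * t)) has_integral (if k = 0 then of_real (2 * pi) else 0)) {0..2*pi}"
proof (cases "k = 0")
  case True
  then show ?thesis
    using has_integral_const_real[of "1::complex" 0 "2*pi"] by (simp add: scaleR_conv_of_real)
next
  case False
  have "((\<lambda>t. cis (of_int k * t)) has_integral
      (cis (of_int k * (2*pi)) / (\<i> * of_int k) - cis (of_int k * 0) / (\<i> * of_int k))) {0..2*pi}"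
  proof (rule fundamental_theorem_of_calculus)
    show "((\<lambda>t. cis (of_int k * t) / (\<i> * of_int k)) has_vector_derivative cis (of_int k * t))
        (at t within {0..2*pi})" for t
    proof -
      have "((\<lambda>z. exp (\<i> * of_int k * z) / (\<i> * of_int k)) has_field_derivative
          exp (\<i> * of_int k * of_real t)) (at (of_real t))"
        using False by (auto intro!: derivative_eq_intros simp: field_simps)
      from has_vector_derivative_real_field[OF this] show ?thesis
        by (simp add: cis_conv_exp mult.assoc)
    qed
  qed simp
  moreover have "cis (of_int k * (2*pi)) = 1"
    using cis_multiple_2pi[of "of_int k"] by (simp add: mult_ac)
  ultimately show ?thesis using False by simp
qed

lemma has_integral_norm_square_trig_poly:
  fixes c :: "nat \<Rightarrow> complex"
  shows "((\<lambda>t. (cmod (\<Sum>n<N. c n * cis (real n * t)))\<^sup>2)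
     has_integral (2 * pi * (\<Sum>n<N. (cmod (c n))\<^sup>2))) {0..2*pi}"
proof -
  have eq: "complex_of_real ((cmod (\<Sum>n<N. c n * cis (real n * t)))\<^sup>2)
     = (\<Sum>n<N. \<Sum>m<N. c n * cnj (c m) * cis (of_int (int n - int m) * t))" for t
  proof -
    have "complex_of_real ((cmod (\<Sum>n<N. c n * cis (real n * t)))\<^sup>2)
      = (\<Sum>n<N. \<Sum>m<N. (c n * cis (real n * t)) * cnj (c m * cis (real m * t)))"
      unfolding complex_norm_square cnj_sum sum_product ..
    also have "\<dots> = (\<Sum>n<N. \<Sum>m<N. c n * cnj (c m) * cis (of_int (int n - int m) * t))"
    proof (intro sum.cong refl)
      fix n m
      have "cis (of_int (int n - int m) * t) = cis (real n * t) * cnj (cis (real m * t))"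
        by (simp add: cis_cnj cis_mult left_diff_distrib)
      thus "(c n * cis (real n * t)) * cnj (c m * cis (real m * t))
          = c n * cnj (c m) * cis (of_int (int n - int m) * t)"
        by (simp only: complex_cnj_mult mult_ac)
    qed
    finally show ?thesis .
  qed
  have "((\<lambda>t. \<Sum>n<N. \<Sum>m<N. c n * cnj (c m) * cis (of_int (int n - int m) * t)) has_integral
      (\<Sum>n<N. \<Sum>m<N. c n * cnj (c m) * (if int n - int m = 0 then of_real (2*pi) else 0))) {0..2*pi}"
    by (intro has_integral_sum has_integral_mult_right has_integral_cis_int) auto
  also have "(\<Sum>n<N. \<Sum>m<N. c n * cnj (c m) * (if int n - int m = 0 then of_real (2*pi) else 0))
     = (\<Sum>n<N. c n * cnj (c n) * of_real (2*pi))"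
    by (intro sum.cong refl) (simp add: if_distrib cong: if_cong)
  also have "\<dots> = of_real (2 * pi * (\<Sum>n<N. (cmod (c n))\<^sup>2))"
    unfolding sum_distrib_left of_real_sum of_real_mult complex_norm_square
    by (intro sum.cong refl) (simp only: mult_ac)
  finally have "((\<lambda>t. complex_of_real ((cmod (\<Sum>n<N. c n * cis (real n * t)))\<^sup>2)) has_integral
      of_real (2 * pi * (\<Sum>n<N. (cmod (c n))\<^sup>2))) {0..2*pi}"
    by (subst eq)
  from has_integral_linear[OF this bounded_linear_Re] show ?thesis by (simp add: o_def)
qed

lemma has_integral_norm_square_fourier:
  fixes c :: "nat \<Rightarrow> complex"
  assumes "summable (\<lambda>n. cmod (c n))"
  shows "summable (\<lambda>n. (cmod (c n))\<^sup>2)"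
    and "((\<lambda>t. (cmod (\<Sum>n. c n * cis (real n * t)))\<^sup>2)
     has_integral (2 * pi * (\<Sum>n. (cmod (c n))\<^sup>2))) {0..2*pi}"
proof -
  let ?S = "\<lambda>N t. (cmod (\<Sum>n<N. c n * cis (real n * t)))\<^sup>2"
  let ?C = "\<Sum>n. cmod (c n)"
  have int: "(?S N has_integral (2 * pi * (\<Sum>n<N. (cmod (c n))\<^sup>2))) {0..2*pi}" for N
    by (rule has_integral_norm_square_trig_poly)
  have le: "?S N t \<le> ?C\<^sup>2" for N t
  proof -
    have "cmod (\<Sum>n<N. c n * cis (real n * t)) \<le> (\<Sum>n<N. cmod (c n))"
      by (rule order_trans[OF norm_sum]) (simp add: norm_mult)
    also have "\<dots> \<le> ?C" by (rule sum_le_suminf[OF assms]) auto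
    finally show ?thesis by (intro power_mono) auto
  qed
  have conv: "(\<lambda>N. ?S N t) \<longlonglongrightarrow> (cmod (\<Sum>n. c n * cis (real n * t)))\<^sup>2" for t
  proof -
    have "summable (\<lambda>n. c n * cis (real n * t))"
      by (rule summable_norm_cancel) (simp add: norm_mult assms)
    thus ?thesis by (intro tendsto_intros) (rule summable_LIMSEQ)
  qed
  show s: "summable (\<lambda>n. (cmod (c n))\<^sup>2)"
  proof (rule summable_comparison_test')
    show "summable (\<lambda>n. ?C * cmod (c n))" using assms by (rule summable_mult)
    show "norm ((cmod (c n))\<^sup>2) \<le> ?C * cmod (c n)" for n
      using sum_le_suminf[OF assms, of "{n}"] by (auto simp: power2_eq_square intro!: mult_right_mono)
  qed
  have i: "(\<lambda>t. (cmod (\<Sum>n. c n * cis (real n * t)))\<^sup>2) integrable_on {0..2*pi}"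
   and l: "(\<lambda>N. integral {0..2*pi} (?S N)) \<longlonglongrightarrow> 
     integral {0..2*pi} (\<lambda>t. (cmod (\<Sum>n. c n * cis (real n * t)))\<^sup>2)"
    using dominated_convergence[of ?S "{0..2*pi}" "\<lambda>_. ?C\<^sup>2"
       "\<lambda>t. (cmod (\<Sum>n. c n * cis (real n * t)))\<^sup>2"] int le conv by auto
  have "(\<lambda>N. integral {0..2*pi} (?S N)) \<longlonglongrightarrow> 2 * pi * (\<Sum>n. (cmod (c n))\<^sup>2)"
    unfolding integral_unique[OF int] by (intro tendsto_intros summable_LIMSEQ s)
  from LIMSEQ_unique[OF l this] integrable_integral[OF i]
  show "((\<lambda>t. (cmod (\<Sum>n. c n * cis (real n * t)))\<^sup>2)
     has_integral (2 * pi * (\<Sum>n. (cmod (c n))\<^sup>2))) {0..2*pi}" by simp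
qed

text \<open>The circle is traversed from an arbitrary point \<open>z\<close> instead of being given
  by a radius; this is the form needed when an area integral is averaged over rotations.\<close>

lemma has_integral_norm_square_circle:
  assumes g: "g holomorphic_on ball 0 1" and z: "cmod z < 1"
  shows "summable (\<lambda>n. (cmod (fps_nth (fps_expansion g 0) n))\<^sup>2 * cmod z ^ (2 * n))"
    and "((\<lambda>t. (cmod (g (z * cis t)))\<^sup>2) has_integral
      (2 * pi * (\<Sum>n. (cmod (fps_nth (fps_expansion g 0) n))\<^sup>2 * cmod z ^ (2 * n)))) {0..2*pi}"
proof -
  define P where "P = fps_expansion g 0"
  have ge: "g holomorphic_on eball 0 (ereal 1)" using g by simp
  have P: "g has_fps_expansion P"
    unfolding P_def using g by (intro has_fps_expansion_fps_expansion[of "ball 0 1"]) auto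
  have R: "fps_conv_radius P \<ge> 1"
    using conv_radius_fps_expansion[OF ge] by (simp add: P_def one_ereal_def)
  have abs: "summable (\<lambda>n. cmod (fps_nth P n * z ^ n))"
  proof -
    have "ereal (norm z) < conv_radius (fps_nth P)"
      using z R unfolding fps_conv_radius_def by (metis ereal_less(3) less_le_trans)
    thus ?thesis by (rule abs_summable_in_conv_radius)
  qed
  have eq: "g (z * cis t) = (\<Sum>n. fps_nth P n * z ^ n * cis (real n * t))" for t
  proof -
    have "(\<lambda>n. fps_nth P n * (z * cis t) ^ n) sums g (z * cis t)"
      using has_fps_expansion_imp_sums_complex[OF P ge, of "z * cis t"] z by (simp add: norm_mult)
    hence "g (z * cis t) = (\<Sum>n. fps_nth P n * (z * cis t) ^ n)" by (rule sums_unique)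
    thus ?thesis by (simp only: power_mult_distrib Complex.DeMoivre mult.assoc)
  qed
  have sq: "(cmod (fps_nth P n * z ^ n))\<^sup>2 = (cmod (fps_nth P n))\<^sup>2 * cmod z ^ (2 * n)" for n
    by (simp add: norm_mult norm_power power_mult_distrib power_mult[symmetric] mult.commute)
  show "summable (\<lambda>n. (cmod (fps_nth (fps_expansion g 0) n))\<^sup>2 * cmod z ^ (2 * n))"
    using has_integral_norm_square_fourier(1)[OF abs] unfolding sq P_def[symmetric] .
  show "((\<lambda>t. (cmod (g (z * cis t)))\<^sup>2) has_integral
      (2 * pi * (\<Sum>n. (cmod (fps_nth (fps_expansion g 0) n))\<^sup>2 * cmod z ^ (2 * n)))) {0..2*pi}"
    using has_integral_norm_square_fourier(2)[OF abs] unfolding sq P_def[symmetric] eq .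
qed

section \<open>Rotation invariance of area, by transport to the Euclidean plane\<close>

definition complex_of_vec :: "real^2 \<Rightarrow> complex" where
  "complex_of_vec v = Complex (v $ 1) (v $ 2)"

definition vec_of_complex :: "complex \<Rightarrow> real^2" where
  "vec_of_complex z = vector [Re z, Im z]"

lemma complex_of_vec_inverse [simp]:
  "complex_of_vec (vec_of_complex z) = z" "vec_of_complex (complex_of_vec v) = v"
  by (simp_all add: complex_of_vec_def vec_of_complex_def vec_eq_iff forall_2)

lemma linear_complex_of_vec: "linear complex_of_vec"
  by (rule linearI) (simp_all add: complex_of_vec_def complex_eq_iff)

lemma linear_vec_of_complex: "linear vec_of_complex"
  by (rule linearI) (simp_all add: vec_of_complex_def vec_eq_iff forall_2)

lemma complex_of_vec_measurable [measurable]: "complex_of_vec \<in> borel \<rightarrow>\<^sub>M borel"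
  by (intro borel_measurable_continuous_onI linear_continuous_on linear_complex_of_vec
        linear_conv_bounded_linear[THEN iffD1])

lemma norm_vec_of_complex: "norm (vec_of_complex z) = cmod z"
  by (simp add: norm_vec_def L2_set_def sum_2 vec_of_complex_def cmod_def)

lemma Basis_vec2: "(Basis :: (real^2) set) = {axis 1 1, axis 2 1}"
  unfolding Basis_vec_def UNIV_2 by auto

lemma vimage_complex_of_vec_box:
  "complex_of_vec -` box l u = box (vec_of_complex l) (vec_of_complex u)"
  by (auto simp: box_def Basis_vec2 Basis_complex_def complex_of_vec_def vec_of_complex_def
      inner_axis)

lemma distr_complex_of_vec: "distr lborel borel complex_of_vec = lborel"
proof (rule lborel_eqI[symmetric])
  fix l u :: complex
  assume le: "\<And>b. b \<in> Basis \<Longrightarrow> l \<bullet> b \<le> u \<bullet> b"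
  have "emeasure (distr lborel borel complex_of_vec) (box l u)
      = emeasure lborel (box (vec_of_complex l) (vec_of_complex u))"
    by (subst emeasure_distr) (simp_all add: vimage_complex_of_vec_box)
  also have "\<dots> = (\<Prod>b\<in>Basis. (vec_of_complex u - vec_of_complex l) \<bullet> b)"
    using le[of 1] le[of \<i>] by (subst emeasure_lborel_box_eq)
      (auto simp: Basis_vec2 Basis_complex_def vec_of_complex_def inner_axis inner_complex_def)
  also have "\<dots> = (\<Prod>b\<in>Basis. (u - l) \<bullet> b)"
    by (simp add: Basis_vec2 Basis_complex_def vec_of_complex_def inner_axis axis_eq_axis complex_eq_iff)
  finally show "emeasure (distr lborel borel complex_of_vec) (box l u)
     = (\<Prod>b\<in>Basis. (u - l) \<bullet> b)" .
qed simp

text \<open>A rotated box is not a box, so its measure cannot be read off. In \<open>real^2\<close>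
  the rotation is an orthogonal transformation, which preserves Lebesgue measure.\<close>

lemma distr_mult_unit_complex:
  assumes c: "cmod c = 1"
  shows "distr lborel borel ((*) c) = (lborel :: complex measure)"
proof (rule lborel_eqI[symmetric])
  fix l u :: complex
  assume le: "\<And>b. b \<in> Basis \<Longrightarrow> l \<bullet> b \<le> u \<bullet> b"
  have c0: "c \<noteq> 0" using c by auto
  \<comment> \<open>The inverse rotation: the preimage of a box under multiplication by
    \<open>c\<close> becomes a forward image under \<open>f\<close>.\<close>
  define f where "f v = vec_of_complex (inverse c * complex_of_vec v)" for v
  define B where "B = box (vec_of_complex l) (vec_of_complex u)"
  have "linear f"
    unfolding f_def
    by (intro linear_compose[OF linear_complex_of_vec, unfolded o_def]
         linear_compose[OF _ linear_vec_of_complex, unfolded o_def] linear_times)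
  moreover have "norm (f v) = norm v" for v
    unfolding f_def norm_vec_of_complex using c norm_vec_of_complex[of "complex_of_vec v"]
    by (simp add: norm_mult norm_inverse)
  ultimately have f: "orthogonal_transformation f"
    by (simp add: orthogonal_transformation)
  have vim: "complex_of_vec -` ((*) c -` box l u) = f ` B"
  proof (intro set_eqI iffI)
    fix v assume "v \<in> complex_of_vec -` ((*) c -` box l u)"
    hence "vec_of_complex (c * complex_of_vec v) \<in> B"
      by (auto simp: B_def vimage_complex_of_vec_box[symmetric])
    moreover have "f (vec_of_complex (c * complex_of_vec v)) = v"
      using c0 by (simp add: f_def flip: mult.assoc)
    ultimately show "v \<in> f ` B" by (metis imageI)
  next
    fix v assume "v \<in> f ` B"
    then obtain w where "w \<in> B" "v = f w" by auto
    thus "v \<in> complex_of_vec -` ((*) c -` box l u)"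
      using c0 by (auto simp: B_def f_def vimage_complex_of_vec_box[symmetric] simp flip: mult.assoc)
  qed
  have meas: "(*) c -` box l u \<in> sets borel"
    using measurable_sets[of "(*) c" borel borel "box l u"] by simp
  have fB: "f ` B \<in> sets borel"
    unfolding vim[symmetric] using measurable_sets[OF complex_of_vec_measurable meas] by simp
  have B: "B \<in> lmeasurable" by (simp add: B_def)
  have "emeasure (distr lborel borel ((*) c)) (box l u) = emeasure lborel ((*) c -` box l u)"
    by (subst emeasure_distr) simp_all
  also have "\<dots> = emeasure lborel (f ` B)"
    by (subst distr_complex_of_vec[symmetric], subst emeasure_distr) (simp_all add: meas vim)
  also have "\<dots> = emeasure lebesgue (f ` B)"
    using fB by simp
  also have "\<dots> = emeasure lebesgue B"
    using measure_orthogonal_image[OF f B] measurable_orthogonal_image[OF f B] B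
    by (simp add: emeasure_eq_measure2)
  also have "\<dots> = emeasure lborel (complex_of_vec -` box l u)"
    by (simp add: B_def vimage_complex_of_vec_box)
  also have "\<dots> = emeasure (distr lborel borel complex_of_vec) (box l u)"
    by (subst emeasure_distr) simp_all
  also have "\<dots> = (\<Prod>b\<in>Basis. (u - l) \<bullet> b)"
    unfolding distr_complex_of_vec using le by (subst emeasure_lborel_box_eq) auto
  finally show "emeasure (distr lborel borel ((*) c)) (box l u) = (\<Prod>b\<in>Basis. (u - l) \<bullet> b)" .
qed simp

lemma nn_integral_rotate:
  fixes f :: "complex \<Rightarrow> ennreal"
  assumes c: "cmod c = 1" and [measurable]: "f \<in> borel_measurable borel"
  shows "(\<integral>\<^sup>+ z. f (c * z) \<partial>lborel) = (\<integral>\<^sup>+ z. f z \<partial>lborel)"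
proof -
  have "(\<integral>\<^sup>+ z. f z \<partial>distr lborel borel ((*) c)) = (\<integral>\<^sup>+ z. f (c * z) \<partial>lborel)"
    by (rule nn_integral_distr) measurable
  thus ?thesis by (simp only: distr_mult_unit_complex[OF c])
qed

section \<open>Area integrals over the disk in terms of Taylor coefficients\<close>

lemma emeasure_complex_ball: "0 \<le> r \<Longrightarrow> emeasure lborel (ball (c::complex) r) = ennreal (pi * r\<^sup>2)"
  by (simp add: emeasure_ball unit_ball_vol_2)

text \<open>Layer cake in place of polar coordinates: |z|^(2n) is the integral of n * s^(n-1) over 0
  \<le> s \<le> |z|^2, and after exchanging the integrals the points with |z|^2 \<ge> s form an
  annulus of area pi * (1 - s). The case \<open>n = 0\<close> stands apart because this
  representation needs n \<ge> 1.\<close>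

lemma nn_integral_disk_norm_power:
  "(\<integral>\<^sup>+ z. ennreal (cmod z ^ (2 * n)) * indicator (ball 0 1) z \<partial>lborel)
     = ennreal (pi / real (n + 1))"
proof (cases "n = 0")
  case True
  then show ?thesis by (simp add: emeasure_complex_ball)
next
  case False
  let ?F = "\<lambda>s. pi * (s ^ n - real n / real (n + 1) * s ^ (n + 1)) :: real"
  define k where "k z s = (if 0 \<le> s \<and> s \<le> (cmod z)\<^sup>2 \<and> cmod z < 1
      then ennreal (real n * s ^ (n - 1)) else 0)" for z :: complex and s :: real
  have k1: "(\<integral>\<^sup>+ s. k z s \<partial>lborel) = ennreal (cmod z ^ (2 * n)) * indicator (ball 0 1) z" for z
  proof -
    have "(\<integral>\<^sup>+ s. ennreal (real n * s ^ (n - 1)) * indicator {0..(cmod z)\<^sup>2} s \<partial>lborel)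
       = ennreal (((cmod z)\<^sup>2) ^ n - 0 ^ n)"
      by (rule nn_integral_FTC_Icc) (auto intro!: derivative_eq_intros)
    moreover have "k z s = ennreal (real n * s ^ (n - 1)) * indicator {0..(cmod z)\<^sup>2} s
        * indicator (ball 0 1) z" for s
      by (auto simp: k_def indicator_def)
    ultimately show ?thesis using False
      by (simp add: nn_integral_multc power_mult power_0_left)
  qed
  have k2: "(\<integral>\<^sup>+ z. k z s \<partial>lborel)
      = ennreal (pi * (real n * s ^ (n - 1) - real n * s ^ n)) * indicator {0..1} s" for s
  proof (cases "0 \<le> s \<and> s \<le> 1")
    case True
    have "k z s = ennreal (real n * s ^ (n - 1)) * indicator (ball 0 1 - ball 0 (sqrt s)) z" for z
      using True real_le_rsqrt[of s "cmod z"] real_sqrt_le_iff[of s "(cmod z)\<^sup>2"]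
      by (auto simp: k_def indicator_def)
    hence "(\<integral>\<^sup>+ z. k z s \<partial>lborel)
       = ennreal (real n * s ^ (n - 1)) * emeasure lborel (ball 0 1 - ball 0 (sqrt s) :: complex set)"
      by (simp add: nn_integral_cmult_indicator)
    also have "emeasure lborel (ball 0 1 - ball 0 (sqrt s) :: complex set) = ennreal (pi - pi * s)"
      using True subset_ball[of "sqrt s" 1 "0::complex"]
      by (subst emeasure_Diff) (simp_all add: emeasure_complex_ball ennreal_minus)
    also have "ennreal (real n * s ^ (n - 1)) * ennreal (pi - pi * s)
        = ennreal (real n * s ^ (n - 1) * (pi - pi * s))"
      using True by (simp add: ennreal_mult'')
    also have "real n * s ^ (n - 1) * (pi - pi * s) = pi * (real n * s ^ (n - 1) - real n * s ^ n)"
      using False by (cases n) (simp_all add: algebra_simps)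
    finally show ?thesis using True by simp
  next
    case out: False
    have "k z s = 0" for z
    proof -
      have "(cmod z)\<^sup>2 \<le> 1" if "cmod z < 1" using that by (simp add: power_le_one)
      thus ?thesis using out by (auto simp: k_def)
    qed
    thus ?thesis using out by simp
  qed
  have k_meas: "case_prod k \<in> borel_measurable (lborel \<Otimes>\<^sub>M lborel)"
    unfolding k_def case_prod_beta by measurable
  have "(\<integral>\<^sup>+ z. ennreal (cmod z ^ (2 * n)) * indicator (ball 0 1) z \<partial>lborel)
      = (\<integral>\<^sup>+ s. \<integral>\<^sup>+ z. k z s \<partial>lborel \<partial>lborel)"
    unfolding k1[symmetric] using lborel_pair.Fubini'[OF k_meas] by simp
  also have "\<dots> = ennreal (?F 1 - ?F 0)"
    unfolding k2
  proof (rule nn_integral_FTC_Icc)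
    show "(?F has_real_derivative pi * (real n * s ^ (n - 1) - real n * s ^ n))
        (at s)" for s
    proof -
      have "(s ^ n + real n * s ^ (n - Suc 0) * s) * real n / (1 + real n) = real n * s ^ n"
        using False by (cases n) (simp_all add: divide_simps, simp add: algebra_simps)
      thus ?thesis by (auto intro!: derivative_eq_intros)
    qed
    show "0 \<le> pi * (real n * s ^ (n - 1) - real n * s ^ n)" if "s \<in> {0..1}" for s
    proof -
      have "s ^ n \<le> s ^ (n - 1)" using that by (intro power_decreasing) auto
      hence "real n * s ^ n \<le> real n * s ^ (n - 1)" by (rule mult_left_mono) simp
      thus ?thesis by simp
    qed
  qed auto
  also have "\<dots> = ennreal (pi / real (n + 1))"
    using False by (simp add: power_0_left field_simps)
  finally show ?thesis .
qed

lemma borel_measurable_norm_square_disk: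
  assumes "g holomorphic_on ball 0 1"
  shows "(\<lambda>z. ennreal ((cmod (g z))\<^sup>2) * indicator (ball 0 1) z) \<in> borel_measurable borel"
proof -
  have "(\<lambda>z. indicator (ball 0 1) z *\<^sub>R g z) \<in> borel_measurable borel"
    using assms
    by (intro borel_measurable_continuous_on_indicator holomorphic_on_imp_continuous_on) auto
  hence "(\<lambda>z. ennreal ((cmod (indicator (ball 0 1) z *\<^sub>R g z))\<^sup>2)) \<in> borel_measurable borel"
    by measurable
  also have "(\<lambda>z. ennreal ((cmod (indicator (ball 0 1) z *\<^sub>R g z))\<^sup>2))
      = (\<lambda>z. ennreal ((cmod (g z))\<^sup>2) * indicator (ball 0 1) z)"
    by (auto simp: indicator_def)
  finally show ?thesis .
qed

text \<open>By rotation invariance the area integral equals its average over all rotations. After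
  Fubini the inner integral runs over a circle, where Parseval applies, and only the integrals of
  |z|^(2n) remain.\<close>

lemma nn_integral_disk_parseval:
  assumes g: "g holomorphic_on ball 0 1"
  shows "(\<integral>\<^sup>+ z. ennreal ((cmod (g z))\<^sup>2) * indicator (ball 0 1) z \<partial>lborel)
    = (\<Sum>n. ennreal (pi * (cmod (fps_nth (fps_expansion g 0) n))\<^sup>2 / real (n + 1)))"
proof -
  define P where "P = fps_nth (fps_expansion g 0)"
  define f where "f z = ennreal ((cmod (g z))\<^sup>2) * indicator (ball 0 1) z" for z
  have [measurable]: "f \<in> borel_measurable borel"
    unfolding f_def by (rule borel_measurable_norm_square_disk[OF g])
  define k where "k z t = f (cis t * z) * indicator {0..2*pi} t" for z and t :: real
  have [measurable]: "cis \<in> borel_measurable borel"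
    by (intro borel_measurable_continuous_onI continuous_intros)
  have k_meas: "case_prod k \<in> borel_measurable (lborel \<Otimes>\<^sub>M lborel)"
    unfolding k_def case_prod_beta by measurable
  have k1: "(\<integral>\<^sup>+ z. k z t \<partial>lborel) = (\<integral>\<^sup>+ z. f z \<partial>lborel) * indicator {0..2*pi} t" for t
    unfolding k_def by (subst nn_integral_multc) (simp_all add: nn_integral_rotate)
  have k2: "(\<integral>\<^sup>+ t. k z t \<partial>lborel) = (\<Sum>n. ennreal (2 * pi * (cmod (P n))\<^sup>2)
      * (ennreal (cmod z ^ (2 * n)) * indicator (ball 0 1) z))" for z
  proof (cases "cmod z < 1")
    case True
    note h = has_integral_norm_square_circle[OF g True, folded P_def]
    have "(\<integral>\<^sup>+ t. k z t \<partial>lborel)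
        = (\<integral>\<^sup>+ t. ennreal ((cmod (g (z * cis t)))\<^sup>2) * indicator {0..2*pi} t \<partial>lborel)"
      using True by (simp add: k_def f_def norm_mult mult.commute)
    also have "\<dots> = ennreal (2 * pi * (\<Sum>n. (cmod (P n))\<^sup>2 * cmod z ^ (2 * n)))"
      by (rule nn_integral_has_integral_lebesgue'[OF _ h(2)]) auto
    also have "\<dots> = ennreal (\<Sum>n. 2 * pi * (cmod (P n))\<^sup>2 * cmod z ^ (2 * n))"
      by (subst suminf_mult[OF h(1), symmetric]) (simp add: mult_ac)
    also have "\<dots> = (\<Sum>n. ennreal (2 * pi * (cmod (P n))\<^sup>2 * cmod z ^ (2 * n)))"
      using summable_mult[OF h(1), of "2*pi"]
      by (intro suminf_ennreal2[symmetric]) (auto simp: mult_ac)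
    finally show ?thesis using True by (simp add: ennreal_mult)
  next
    case False
    then show ?thesis by (simp add: k_def f_def norm_mult)
  qed
  have "ennreal (2 * pi) * (\<integral>\<^sup>+ z. f z \<partial>lborel) = (\<integral>\<^sup>+ t. \<integral>\<^sup>+ z. k z t \<partial>lborel \<partial>lborel)"
    unfolding k1 by (simp add: nn_integral_cmult_indicator mult.commute)
  also have "\<dots> = (\<integral>\<^sup>+ z. \<integral>\<^sup>+ t. k z t \<partial>lborel \<partial>lborel)"
    using lborel_pair.Fubini'[OF k_meas] by simp
  also have "\<dots> = (\<Sum>n. ennreal (2 * pi * (cmod (P n))\<^sup>2) * ennreal (pi / real (n + 1)))"
  proof -
    have m: "(\<lambda>z. ennreal (cmod z ^ (2 * n)) * indicator (ball 0 1) z) \<in> borel_measurable borel" for n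
    proof -
      have "(\<lambda>z. ennreal (cmod z ^ (2 * n)) * indicator (ball 0 1) z)
         = (\<lambda>z. if cmod z < 1 then ennreal (cmod z ^ (2 * n)) else 0)" by auto
      thus ?thesis by simp
    qed
    show ?thesis unfolding k2
      by (subst nn_integral_suminf)
         (auto intro!: suminf_cong borel_measurable_times_ennreal m
            simp: nn_integral_cmult m nn_integral_disk_norm_power[simplified])
  qed
  also have "\<dots> = (\<Sum>n. ennreal (2 * pi) * ennreal (pi * (cmod (P n))\<^sup>2 / real (n + 1)))"
    by (intro suminf_cong) (simp add: ennreal_mult[symmetric] mult_ac)
  also have "\<dots> = ennreal (2 * pi) * (\<Sum>n. ennreal (pi * (cmod (P n))\<^sup>2 / real (n + 1)))"
    by (rule ennreal_suminf_cmult)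
  finally have "(\<integral>\<^sup>+ z. f z \<partial>lborel) = (\<Sum>n. ennreal (pi * (cmod (P n))\<^sup>2 / real (n + 1)))"
    by (subst (asm) ennreal_mult_cancel_left) (use pi_gt_zero in \<open>auto simp: ennreal_eq_0_iff not_le simp del: pi_gt_zero\<close>)
  thus ?thesis unfolding f_def P_def .
qed

lemma nn_integral_disk_area_measure:
  assumes g: "g holomorphic_on ball 0 1"
  shows "(\<integral>\<^sup>+ z. ennreal ((cmod (g z))\<^sup>2) \<partial>disk_area_measure)
    = (\<integral>\<^sup>+ z. ennreal ((cmod (g z))\<^sup>2) * indicator (ball 0 1) z \<partial>lborel) / ennreal pi"
proof -
  define f where "f z = ennreal ((cmod (g z))\<^sup>2) * indicator (ball 0 1) z" for z
  have [measurable]: "f \<in> borel_measurable borel"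
    unfolding f_def by (rule borel_measurable_norm_square_disk[OF g])
  have "(\<integral>\<^sup>+ z. ennreal ((cmod (g z))\<^sup>2) \<partial>disk_area_measure) = (\<integral>\<^sup>+ z. f z \<partial>disk_area_measure)"
    unfolding disk_area_measure_def
    by (intro nn_integral_cong_AE AE_uniform_measureI) (auto simp: f_def)
  also have "\<dots> = (\<integral>\<^sup>+ z. f z * indicator (ball 0 1) z \<partial>lborel) / emeasure lborel (ball (0::complex) 1)"
    unfolding disk_area_measure_def by (rule nn_integral_uniform_measure) auto
  also have "(\<integral>\<^sup>+ z. f z * indicator (ball 0 1) z \<partial>lborel)
     = (\<integral>\<^sup>+ z. ennreal ((cmod (g z))\<^sup>2) * indicator (ball 0 1) z \<partial>lborel)"
    by (intro nn_integral_cong) (auto simp: f_def indicator_def)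
  finally show ?thesis by (simp add: emeasure_complex_ball)
qed

text \<open>The coefficient (n + 1) * f_(n+1) of the derivative is squared and divided by n + 1.
  With normalised area no constant is left, so the numbers \<open>dirichlet_partial\<close> are
  exactly the partial sums of the Dirichlet integral.\<close>

lemma nn_integral_deriv_disk:
  assumes f: "f holomorphic_on ball 0 1"
  shows "(\<integral>\<^sup>+ z. ennreal ((cmod (deriv f z))\<^sup>2) \<partial>disk_area_measure)
    = (\<Sum>n. ennreal (real n * (cmod (fps_nth (fps_expansion f 0) n))\<^sup>2))"
proof -
  let ?F = "\<lambda>n. fps_nth (fps_expansion f 0) n"
  define h where "h n = ennreal (real n * (cmod (?F n))\<^sup>2)" for n
  have d: "deriv f holomorphic_on ball 0 1" using f by (intro holomorphic_deriv) auto
  have nth: "fps_nth (fps_expansion (deriv f) 0) n = of_nat (n + 1) * ?F (n + 1)" for n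
    using of_nat_neq_0[of n, where 'a = complex]
    by (simp add: fps_expansion_def funpow_Suc_right del: funpow.simps of_nat_neq_0)
  have "(\<integral>\<^sup>+ z. ennreal ((cmod (deriv f z))\<^sup>2) * indicator (ball 0 1) z \<partial>lborel)
      = (\<Sum>n. ennreal pi * ennreal (real (n + 1) * (cmod (?F (n + 1)))\<^sup>2))"
    unfolding nn_integral_disk_parseval[OF d] nth
    by (intro suminf_cong)
       (simp add: ennreal_mult[symmetric] norm_mult power_mult_distrib power2_eq_square field_simps
          del: of_nat_Suc)
  also have "\<dots> = ennreal pi * (\<Sum>n. ennreal (real (n + 1) * (cmod (?F (n + 1)))\<^sup>2))"
    by (rule ennreal_suminf_cmult)
  finally have "(\<integral>\<^sup>+ z. ennreal ((cmod (deriv f z))\<^sup>2) * indicator (ball 0 1) z \<partial>lborel)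
      = ennreal pi * (\<Sum>n. h (n + 1))" by (simp only: h_def)
  moreover have "(\<Sum>n. h (n + 1)) = (\<Sum>n. h n)"
  proof -
    have "(\<Sum>n. h n) = (\<Sum>n. h (n + 1)) + (\<Sum>n<1. h n)"
      by (rule suminf_offset) (rule summableI)
    also have "(\<Sum>n<1. h n) = 0" unfolding h_def by simp
    finally show ?thesis by (simp only: add_0_right)
  qed
  ultimately have I: "(\<integral>\<^sup>+ z. ennreal ((cmod (deriv f z))\<^sup>2) * indicator (ball 0 1) z \<partial>lborel)
      = ennreal pi * (\<Sum>n. h n)" by (simp only:)
  have "(\<integral>\<^sup>+ z. ennreal ((cmod (deriv f z))\<^sup>2) \<partial>disk_area_measure)
      = ennreal pi * (\<Sum>n. h n) / ennreal pi"
    unfolding nn_integral_disk_area_measure[OF d] I ..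
  also have "\<dots> = (\<Sum>n. h n)"
    unfolding mult.commute[of "ennreal pi"]
    by (rule mult_divide_eq_ennreal) (simp_all add: ennreal_eq_0_iff not_le)
  finally show ?thesis by (simp only: h_def)
qed

section \<open>Finite Blaschke products and the Cauchy kernel\<close>

lemma inverse_one_minus_const_X:
  "inverse (1 - fps_const c * fps_X) = (Abs_fps (\<lambda>n. c ^ n) :: complex fps)"
proof -
  have "(1 - fps_const c * fps_X) * Abs_fps (\<lambda>n. c ^ n) = 1"
  proof (rule fps_ext)
    fix n show "fps_nth ((1 - fps_const c * fps_X) * Abs_fps (\<lambda>n. c ^ n)) n = fps_nth 1 n"
      by (cases n) (simp_all add: algebra_simps)
  qed
  thus ?thesis
    using linear_factor_inverse_fps[of c "Abs_fps (\<lambda>n. c ^ n)"]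
    by (metis mult.assoc mult.left_neutral)
qed

lemma one_minus_cnj_mult_nonzero:
  assumes "cmod a < 1" "cmod w < 1"
  shows "1 - cnj a * w \<noteq> 0"
proof
  assume "1 - cnj a * w = 0"
  hence "cmod (cnj a * w) = 1" by simp
  moreover have "cmod a * cmod w < 1 * 1"
    using assms by (intro mult_strict_mono') auto
  ultimately show False by (simp add: norm_mult)
qed

lemma cauchy_kernel_expansion:
  assumes "cmod a < 1"
  shows "fps_expansion (\<lambda>w. 1 / (1 - cnj a * w)) 0 = inverse (1 - fps_const (cnj a) * fps_X)"
  by (rule fps_expansion_eqI) (auto intro!: fps_expansion_intros simp: divide_inverse)

text \<open>The pointwise hypothesis is integrated over circles of radius r < 1, and then r tends to
  1, so \<open>F\<close> enters only through interior points. The term with \<epsilon> is a multiple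
  of the Poisson kernel, which has mass 1; the constant \<eta> keeps the factor
  \<open>1 - (cmod a)\<^sup>2\<close>.\<close>

lemma hardy_partial_cauchy_kernel_le:
  assumes F: "F holomorphic_on ball 0 1" and a: "cmod a < 1" and "0 \<le> \<epsilon>" "0 \<le> \<eta>"
    and bound: "\<And>w. cmod w < 1 \<Longrightarrow>
       (cmod (F w))\<^sup>2 / (cmod (1 - cnj a * w))\<^sup>2 \<le> \<epsilon> / (cmod (1 - cnj a * w))\<^sup>2 + \<eta>"
  shows "(1 - (cmod a)\<^sup>2)
      * hardy_partial (fps_expansion F 0 * inverse (1 - fps_const (cnj a) * fps_X)) N
    \<le> \<epsilon> + \<eta> * (1 - (cmod a)\<^sup>2)"
proof -
  define k where "k w = 1 / (1 - cnj a * w)" for w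
  define h where "h w = F w * k w" for w
  define H where "H = fps_expansion F 0 * inverse (1 - fps_const (cnj a) * fps_X)"
  have a2: "(cmod a)\<^sup>2 < 1" using a by (simp add: power_less_one_iff abs_square_less_1)
  have k: "k holomorphic_on ball 0 1"
    unfolding k_def using one_minus_cnj_mult_nonzero[OF a] by (auto intro!: holomorphic_intros)
  have h: "h holomorphic_on ball 0 1"
    unfolding h_def by (intro holomorphic_intros F k)
  have kexp: "k has_fps_expansion inverse (1 - fps_const (cnj a) * fps_X)"
    unfolding k_def cauchy_kernel_expansion[OF a, symmetric] using k[unfolded k_def]
    by (intro has_fps_expansion_fps_expansion[of "ball 0 1"]) auto
  have hexp: "fps_expansion h 0 = H"
    unfolding h_def H_def
    by (intro fps_expansion_eqI has_fps_expansion_mult kexp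
        has_fps_expansion_fps_expansion[of "ball 0 1"] F) auto
  have step: "(\<Sum>n\<le>N. (cmod (fps_nth H n))\<^sup>2 * r ^ (2 * n)) \<le> \<epsilon> / (1 - (cmod a)\<^sup>2) + \<eta>"
    if r: "0 \<le> r" "r < 1" for r
  proof -
    have nr: "cmod (of_real r) = r" "cmod (of_real r) < 1" using r by auto
    note ih = has_integral_norm_square_circle[OF h nr(2), unfolded hexp nr(1)]
    note ik = has_integral_norm_square_circle[OF k nr(2), unfolded fps_expansion_eqI[OF kexp] nr(1)]
    let ?Sh = "\<Sum>n. (cmod (fps_nth H n))\<^sup>2 * r ^ (2 * n)"
    let ?Sk = "\<Sum>n. (cmod (fps_nth (inverse (1 - fps_const (cnj a) * fps_X)) n))\<^sup>2 * r ^ (2 * n)"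
    have knth: "(cmod (fps_nth (inverse (1 - fps_const (cnj a) * fps_X)) n))\<^sup>2 = ((cmod a)\<^sup>2) ^ n" for n
      unfolding inverse_one_minus_const_X by (simp add: norm_power power_mult[symmetric] mult.commute)
    have "((\<lambda>t. \<epsilon> * (cmod (k (of_real r * cis t)))\<^sup>2 + \<eta>) has_integral
        (\<epsilon> * (2 * pi * ?Sk) + 2 * pi * \<eta>)) {0..2*pi}"
      using has_integral_add[OF has_integral_mult_right[OF ik(2)] has_integral_const_real[of \<eta> 0 "2*pi"]]
      by simp
    hence "2 * pi * ?Sh \<le> \<epsilon> * (2 * pi * ?Sk) + 2 * pi * \<eta>"
    proof (rule has_integral_le[OF ih(2)])
      fix t
      have "cmod (of_real r * cis t) < 1" using r by (simp add: norm_mult)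
      from bound[OF this] show "(cmod (h (of_real r * cis t)))\<^sup>2
          \<le> \<epsilon> * (cmod (k (of_real r * cis t)))\<^sup>2 + \<eta>"
        by (simp add: h_def k_def norm_mult norm_divide power_mult_distrib power_divide)
    qed
    hence "2 * pi * ?Sh \<le> 2 * pi * (\<epsilon> * ?Sk + \<eta>)" by (simp add: algebra_simps)
    hence "?Sh \<le> \<epsilon> * ?Sk + \<eta>" by simp
    moreover have "?Sk \<le> (\<Sum>n. ((cmod a)\<^sup>2) ^ n)"
    proof (rule suminf_le[OF _ ik(1)])
      show "(cmod (fps_nth (inverse (1 - fps_const (cnj a) * fps_X)) n))\<^sup>2 * r ^ (2 * n)
          \<le> ((cmod a)\<^sup>2) ^ n" for n
        unfolding knth using r by (intro mult_left_le) (auto intro: power_le_one)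
      show "summable (\<lambda>n. ((cmod a)\<^sup>2) ^ n)" using a2 by (intro summable_geometric) simp
    qed
    hence "?Sk \<le> 1 / (1 - (cmod a)\<^sup>2)" using a2 by (subst (asm) suminf_geometric) auto
    hence "\<epsilon> * ?Sk \<le> \<epsilon> / (1 - (cmod a)\<^sup>2)"
      using mult_left_mono[OF _ \<open>0 \<le> \<epsilon>\<close>, of ?Sk "1 / (1 - (cmod a)\<^sup>2)"] by simp
    moreover have "(\<Sum>n\<le>N. (cmod (fps_nth H n))\<^sup>2 * r ^ (2 * n)) \<le> ?Sh"
      using r by (intro sum_le_suminf ih(1)) auto
    ultimately show ?thesis by linarith
  qed
  \<comment> \<open>For fixed \<open>N\<close> the left side is a polynomial in r, so the limit
    needs only continuity.\<close>
  have "((\<lambda>r. \<Sum>n\<le>N. (cmod (fps_nth H n))\<^sup>2 * r ^ (2 * n)) \<longlongrightarrow>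
      (\<Sum>n\<le>N. (cmod (fps_nth H n))\<^sup>2 * 1 ^ (2 * n))) (at_left (1::real))"
    by (intro tendsto_intros)
  hence "(\<Sum>n\<le>N. (cmod (fps_nth H n))\<^sup>2 * 1 ^ (2 * n)) \<le> \<epsilon> / (1 - (cmod a)\<^sup>2) + \<eta>"
  proof (rule tendsto_upperbound)
    have "eventually (\<lambda>r::real. r \<in> {0<..<1}) (at_left 1)"
      by (rule eventually_at_leftI) auto
    thus "\<forall>\<^sub>F r in at_left 1. (\<Sum>n\<le>N. (cmod (fps_nth H n))\<^sup>2 * r ^ (2 * n))
        \<le> \<epsilon> / (1 - (cmod a)\<^sup>2) + \<eta>"
      by eventually_elim (auto intro!: step)
  qed simp
  hence "hardy_partial H N \<le> \<epsilon> / (1 - (cmod a)\<^sup>2) + \<eta>" by (simp add: hardy_partial_def)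
  hence "(1 - (cmod a)\<^sup>2) * hardy_partial H N \<le> (1 - (cmod a)\<^sup>2) * (\<epsilon> / (1 - (cmod a)\<^sup>2) + \<eta>)"
    using a2 by (intro mult_left_mono) auto
  also have "\<dots> = \<epsilon> + \<eta> * (1 - (cmod a)\<^sup>2)" using a2 by (simp add: field_simps)
  finally show ?thesis by (simp only: H_def)
qed

definition blaschke_prod :: "complex set \<Rightarrow> complex \<Rightarrow> complex" where
  "blaschke_prod A z = (\<Prod>a\<in>A. (z - a) / (1 - cnj a * z))"

lemma holomorphic_blaschke_prod [holomorphic_intros]:
  assumes "A \<subseteq> ball 0 1"
  shows "blaschke_prod A holomorphic_on ball 0 1"
  unfolding blaschke_prod_def using assms one_minus_cnj_mult_nonzero
  by (intro holomorphic_intros) auto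

lemma blaschke_prod_has_fps_expansion:
  assumes "A \<subseteq> ball 0 1"
  shows "blaschke_prod A has_fps_expansion (\<Prod>a\<in>A. blaschke_fps a)"
  unfolding blaschke_prod_def blaschke_fps_def divide_inverse using assms
  by (auto intro!: fps_expansion_intros)

lemma nn_integral_deriv_blaschke_le:
  assumes F: "F holomorphic_on ball 0 1" and A: "finite A" "A \<subseteq> ball 0 1"
    and M: "(\<integral>\<^sup>+ z. ennreal ((cmod (deriv F z))\<^sup>2) \<partial>disk_area_measure) \<le> ennreal M" "0 \<le> M"
    and K: "\<And>N. (\<Sum>a\<in>A. (1 - (cmod a)\<^sup>2)
      * hardy_partial (fps_expansion F 0 * inverse (1 - fps_const (cnj a) * fps_X)) N) \<le> K"
  shows "(\<integral>\<^sup>+ z. ennreal ((cmod (deriv (\<lambda>z. F z * blaschke_prod A z) z))\<^sup>2) \<partial>disk_area_measure)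
     \<le> ennreal (M + K)"
proof -
  define P where "P = fps_expansion F 0 * (\<Prod>a\<in>A. blaschke_fps a)"
  have f: "(\<lambda>z. F z * blaschke_prod A z) holomorphic_on ball 0 1"
    by (intro holomorphic_intros F A)
  have fexp: "fps_expansion (\<lambda>z. F z * blaschke_prod A z) 0 = P"
    unfolding P_def
    by (intro fps_expansion_eqI has_fps_expansion_mult blaschke_prod_has_fps_expansion A
        has_fps_expansion_fps_expansion[of "ball 0 1"] F) auto
  have part: "(\<Sum>n\<le>N. ennreal (real n * (cmod (fps_nth g n))\<^sup>2)) = ennreal (dirichlet_partial g N)"
    for g N unfolding dirichlet_partial_def by (intro sum_ennreal) auto
  have FM: "dirichlet_partial (fps_expansion F 0) N \<le> M" for N
  proof -
    have "ennreal (dirichlet_partial (fps_expansion F 0) N) \<le> ennreal M"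
      unfolding part[symmetric]
      by (rule order_trans[OF sum_le_suminf M(1)[unfolded nn_integral_deriv_disk[OF F]]])
        (auto intro: summableI)
    thus ?thesis using M(2) by simp
  qed
  have PM: "dirichlet_partial P N \<le> M + K" for N
  proof -
    have "dirichlet_partial P N \<le> dirichlet_partial (fps_expansion F 0) N
        + (\<Sum>a\<in>A. (1 - (cmod a)\<^sup>2)
             * hardy_partial (fps_expansion F 0 * inverse (1 - fps_const (cnj a) * fps_X)) N)"
      unfolding P_def using A by (intro dirichlet_partial_blaschke_prod_le) auto
    also have "\<dots> \<le> M + K"
      by (intro add_mono FM K)
    finally show ?thesis .
  qed
  show ?thesis
    unfolding nn_integral_deriv_disk[OF f] fexp
  proof (rule suminf_le_const[OF summableI])
    fix N
    have "(\<Sum>n<N. ennreal (real n * (cmod (fps_nth P n))\<^sup>2))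
       \<le> (\<Sum>n\<le>N. ennreal (real n * (cmod (fps_nth P n))\<^sup>2))"
      by (intro sum_mono2) auto
    also have "\<dots> \<le> ennreal (M + K)"
      unfolding part using PM by (rule ennreal_leI)
    finally show "(\<Sum>n<N. ennreal (real n * (cmod (fps_nth P n))\<^sup>2)) \<le> ennreal (M + K)" .
  qed
qed

section \<open>An outer function that is small near prescribed boundary points\<close>

text \<open>Dyadic shells around \<zeta>: where |z - \<zeta>| is about 2^(-k), the logarithm is at
  least (k + 1) * ln 2, the factor 1 / |z - \<zeta>|^2 is at most 4^k, and the area is of order
  4^(-k). Shell k thus contributes a multiple of (k + 1)^(s-2), which is summable because s <
  1.\<close>

lemma nn_integral_log_kernel_bound:
  fixes s :: real
  assumes s: "s < 1"
  obtains C where "0 \<le> C"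
    "\<And>\<zeta>. (\<integral>\<^sup>+ z. ennreal (ln (4 / cmod (z - \<zeta>)) powr (s - 2) / (cmod (z - \<zeta>))\<^sup>2)
        * indicator (ball \<zeta> 2 - {\<zeta>}) z \<partial>lborel) \<le> ennreal C"
proof -
  define b where "b k = (real (k + 1) * ln 2) powr (s - 2) * 4 ^ k" for k
  define a where "a k = b k * (pi * (2 / 2 ^ k)\<^sup>2)" for k
  have b0: "0 \<le> b k" for k by (simp add: b_def)
  have a0: "0 \<le> a k" for k by (simp add: a_def b0)
  have "summable (\<lambda>k. real (Suc k) powr (s - 2))"
    using s summable_real_powr_iff[of "s - 2"]
    by (subst summable_Suc_iff[of "\<lambda>k. real k powr (s - 2)"]) simp
  hence "summable (\<lambda>k. (4 * pi * ln 2 powr (s - 2)) * real (Suc k) powr (s - 2))"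
    by (rule summable_mult)
  also have "(\<lambda>k. (4 * pi * ln 2 powr (s - 2)) * real (Suc k) powr (s - 2)) = a"
  proof
    fix k
    have "(4::real) ^ k = (2 ^ k)\<^sup>2" by (simp add: power2_eq_square power_mult_distrib[symmetric])
    thus "(4 * pi * ln 2 powr (s - 2)) * real (Suc k) powr (s - 2) = a k"
      by (simp add: a_def b_def powr_mult power_divide)
  qed
  finally have sum_a: "summable a" .
  \<comment> \<open>Discs replace the shells as a majorant; their areas differ by a bounded factor
    only.\<close>
  have shell: "ennreal (ln (4 / u) powr (s - 2) / u\<^sup>2)
      \<le> (\<Sum>k. ennreal (b k) * indicator {..<2 / 2 ^ k} u)" if u: "0 < u" "u < 2" for u :: real
  proof -
    \<comment> \<open>The index with 2^(-k) \<le> u < 2 * 2^(-k); the assumption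
      \<open>u < 2\<close> is what covers \<open>k = 0\<close>.\<close>
    define k where "k = (LEAST k. 1 / 2 ^ k \<le> u)"
    obtain k0 where "(1 / 2) ^ k0 < u" using real_arch_pow_inv[of u "1/2"] u by auto
    hence "1 / 2 ^ k0 \<le> u" by (simp add: power_divide)
    hence k1: "1 / 2 ^ k \<le> u" unfolding k_def by (rule LeastI)
    have k2: "u < 2 / 2 ^ k"
    proof (cases k)
      case 0
      thus ?thesis using u by simp
    next
      case (Suc j)
      hence "\<not> 1 / 2 ^ j \<le> u" using not_less_Least[of j "\<lambda>k. 1 / 2 ^ k \<le> u"] by (simp add: k_def)
      thus ?thesis using Suc by simp
    qed
    have "real (k + 1) * ln 2 = ln (2 ^ (k + 1))" by (simp add: ln_realpow del: power_Suc)
    also have "\<dots> \<le> ln (4 / u)" using k2 u by (subst ln_le_cancel_iff) (auto simp: field_simps)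
    finally have le: "ln (4 / u) powr (s - 2) \<le> (real (k + 1) * ln 2) powr (s - 2)"
      using s by (intro powr_mono2') auto
    have "1 \<le> u * 2 ^ k" using k1 by (simp add: field_simps)
    hence "1 \<le> (u * 2 ^ k)\<^sup>2" by simp
    moreover have "(4::real) ^ k = (2 ^ k)\<^sup>2"
      by (simp add: power2_eq_square power_mult_distrib[symmetric])
    ultimately have "1 / u\<^sup>2 \<le> 4 ^ k"
      using u by (simp add: power_mult_distrib field_simps)
    with le have "ln (4 / u) powr (s - 2) * (1 / u\<^sup>2) \<le> b k"
      unfolding b_def by (intro mult_mono) auto
    hence "ennreal (ln (4 / u) powr (s - 2) / u\<^sup>2)
        \<le> (\<Sum>j\<in>{k}. ennreal (b j) * indicator {..<2 / 2 ^ j} u)"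
      using k2 by (simp add: ennreal_leI)
    also have "\<dots> \<le> (\<Sum>j. ennreal (b j) * indicator {..<2 / 2 ^ j} u)"
      by (intro sum_le_suminf summableI) auto
    finally show ?thesis .
  qed
  show ?thesis
  proof
    show "0 \<le> suminf a" using a0 sum_a by (intro suminf_nonneg)
    fix \<zeta> :: complex
    have "(\<integral>\<^sup>+ z. ennreal (ln (4 / cmod (z - \<zeta>)) powr (s - 2) / (cmod (z - \<zeta>))\<^sup>2)
        * indicator (ball \<zeta> 2 - {\<zeta>}) z \<partial>lborel)
       \<le> (\<integral>\<^sup>+ z. (\<Sum>k. ennreal (b k) * indicator (ball \<zeta> (2 / 2 ^ k)) z) \<partial>lborel)"
    proof (rule nn_integral_mono)
      fix z
      have ind: "indicator {..<2 / 2 ^ k} (cmod (z - \<zeta>)) = (indicator (ball \<zeta> (2 / 2 ^ k)) z :: ennreal)" for k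
        by (simp add: indicator_def dist_norm norm_minus_commute)
      show "ennreal (ln (4 / cmod (z - \<zeta>)) powr (s - 2) / (cmod (z - \<zeta>))\<^sup>2)
        * indicator (ball \<zeta> 2 - {\<zeta>}) z \<le> (\<Sum>k. ennreal (b k) * indicator (ball \<zeta> (2 / 2 ^ k)) z)"
        using shell[of "cmod (z - \<zeta>)"] unfolding ind
        by (cases "z \<in> ball \<zeta> 2 - {\<zeta>}") (auto simp: dist_norm norm_minus_commute)
    qed
    also have "\<dots> = (\<Sum>k. ennreal (a k))"
      by (subst nn_integral_suminf)
         (auto intro!: borel_measurable_times_ennreal borel_measurable_indicator
           simp: nn_integral_cmult_indicator emeasure_complex_ball a_def b0 ennreal_mult')
    also have "\<dots> = ennreal (suminf a)" by (intro suminf_ennreal2 a0 sum_a)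
    finally show "(\<integral>\<^sup>+ z. ennreal (ln (4 / cmod (z - \<zeta>)) powr (s - 2) / (cmod (z - \<zeta>))\<^sup>2)
        * indicator (ball \<zeta> 2 - {\<zeta>}) z \<partial>lborel) \<le> ennreal (suminf a)" .
  qed
qed

text \<open>A branch of log (4 / (1 - cnj \<zeta> * z)). As |z - \<zeta>| < 2 in the disk, the
  constant 4 keeps the real part above \<open>ln 2\<close>, so principal powers of it are
  holomorphic there.\<close>

definition boundary_log :: "complex \<Rightarrow> complex \<Rightarrow> complex" where
  "boundary_log \<zeta> z = of_real (ln 4) - Ln (1 - cnj \<zeta> * z)"

context
  fixes \<zeta> z :: complex
  assumes unit: "cmod \<zeta> = 1" and disk: "cmod z < 1"
begin

lemma Re_one_minus_cnj_mult_pos: "0 < Re (1 - cnj \<zeta> * z)"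
proof -
  have "Re (cnj \<zeta> * z) \<le> cmod (cnj \<zeta> * z)" by (rule complex_Re_le_cmod)
  also have "\<dots> < 1" using unit disk by (simp add: norm_mult)
  finally show ?thesis by simp
qed

lemma one_minus_cnj_unit_mult_nonzero: "1 - cnj \<zeta> * z \<noteq> 0"
  using Re_one_minus_cnj_mult_pos by force

lemma cmod_one_minus_cnj_mult: "cmod (1 - cnj \<zeta> * z) = cmod (z - \<zeta>)"
proof -
  have "\<zeta> * cnj \<zeta> = 1" using unit complex_norm_square[of \<zeta>] by simp
  hence "1 - cnj \<zeta> * z = cnj \<zeta> * (\<zeta> - z)" by (simp add: algebra_simps)
  thus ?thesis using unit by (simp add: norm_mult norm_minus_commute)
qed

lemma dist_unit_bounds: "0 < cmod (z - \<zeta>)" "cmod (z - \<zeta>) < 2"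
proof -
  show "0 < cmod (z - \<zeta>)" using unit disk by auto
  show "cmod (z - \<zeta>) < 2" using norm_triangle_ineq4[of z \<zeta>] unit disk by simp
qed

lemma Re_boundary_log: "Re (boundary_log \<zeta> z) = ln (4 / cmod (z - \<zeta>))"
  using dist_unit_bounds
  by (simp add: boundary_log_def Re_Ln[OF one_minus_cnj_unit_mult_nonzero]
      cmod_one_minus_cnj_mult ln_div)

lemma Re_boundary_log_pos: "0 < Re (boundary_log \<zeta> z)"
  unfolding Re_boundary_log using dist_unit_bounds by (intro ln_gt_zero) (simp add: field_simps)

lemma boundary_log_notin_nonpos [simp]: "boundary_log \<zeta> z \<notin> \<real>\<^sub>\<le>\<^sub>0"
  using Re_boundary_log_pos by (auto simp: complex_nonpos_Reals_iff)

lemma cmod_boundary_log_ge: "ln (4 / cmod (z - \<zeta>)) \<le> cmod (boundary_log \<zeta> z)"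
  using complex_Re_le_cmod[of "boundary_log \<zeta> z"] by (simp add: Re_boundary_log)

lemma cmod_boundary_log_le: "cmod (boundary_log \<zeta> z) \<le> ln (4 / cmod (z - \<zeta>)) + pi / 2"
proof -
  have "\<bar>Im (Ln (1 - cnj \<zeta> * z))\<bar> \<le> pi / 2"
    using Re_Ln_pos_lt[OF one_minus_cnj_unit_mult_nonzero] Re_one_minus_cnj_mult_pos
    by (simp add: less_imp_le)
  hence "\<bar>Im (boundary_log \<zeta> z)\<bar> \<le> pi / 2" by (simp add: boundary_log_def)
  thus ?thesis using cmod_le[of "boundary_log \<zeta> z"] Re_boundary_log_pos Re_boundary_log by linarith
qed

lemma cmod_boundary_log_powr:
  "cmod (boundary_log \<zeta> z powr of_real s) = cmod (boundary_log \<zeta> z) powr s"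
  using Re_boundary_log_pos by (subst norm_powr_real_powr') auto

text \<open>The logarithm lies in the right half-plane, so its argument is at most pi / 2 in
  absolute value and that of its power at most s * pi / 2. For s < 1 the cosine of this angle is
  positive, which makes the real part comparable to the modulus.\<close>

lemma Re_boundary_log_powr_ge:
  assumes "0 \<le> s" "s \<le> 1"
  shows "cos (s * (pi / 2)) * cmod (boundary_log \<zeta> z) powr s
     \<le> Re (boundary_log \<zeta> z powr of_real s)"
proof -
  let ?L = "boundary_log \<zeta> z"
  have nz: "?L \<noteq> 0" using Re_boundary_log_pos by auto
  have im: "\<bar>Im (Ln ?L)\<bar> \<le> pi / 2"
    using Re_Ln_pos_lt[of ?L] nz Re_boundary_log_pos by force
  have "cos (s * (pi / 2)) \<le> cos \<bar>s * Im (Ln ?L)\<bar>"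
  proof (rule cos_monotone_0_pi_le)
    show "\<bar>s * Im (Ln ?L)\<bar> \<le> s * (pi / 2)"
      using mult_left_mono[OF im assms(1)] assms(1) by (simp add: abs_mult)
    show "s * (pi / 2) \<le> pi" using assms mult_right_mono[of s 1 "pi/2"] by simp
  qed simp
  hence "cos (s * (pi / 2)) \<le> cos (s * Im (Ln ?L))" by (simp only: cos_abs_real)
  moreover have "Re (?L powr of_real s) = cmod ?L powr s * cos (s * Im (Ln ?L))"
    using nz by (simp add: powr_def Re_exp)
  ultimately show ?thesis by (simp add: mult.commute mult_left_mono)
qed

lemma has_field_derivative_boundary_log_powr:
  "((\<lambda>z. boundary_log \<zeta> z powr of_real s) has_field_derivative
     of_real s * boundary_log \<zeta> z powr of_real (s - 1) * (cnj \<zeta> / (1 - cnj \<zeta> * z))) (at z)"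
proof -
  have "1 - cnj \<zeta> * z \<notin> \<real>\<^sub>\<le>\<^sub>0"
    using Re_one_minus_cnj_mult_pos by (auto simp: complex_nonpos_Reals_iff)
  hence "(boundary_log \<zeta> has_field_derivative (cnj \<zeta> / (1 - cnj \<zeta> * z))) (at z)"
    unfolding boundary_log_def by (auto intro!: derivative_eq_intros simp: divide_inverse)
  from DERIV_chain2[OF has_field_derivative_powr[OF boundary_log_notin_nonpos] this]
  show ?thesis by simp
qed

end

section \<open>The outer function: size and derivative\<close>

definition outer_fun :: "real \<Rightarrow> ('i \<Rightarrow> real) \<Rightarrow> ('i \<Rightarrow> complex) \<Rightarrow> 'i set \<Rightarrow> complex \<Rightarrow> complex" where
  "outer_fun s c \<zeta> I z = exp (- (\<Sum>i\<in>I. of_real (c i) * boundary_log (\<zeta> i) z powr of_real s))"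

context
  fixes s :: real and c :: "'i \<Rightarrow> real" and \<zeta> :: "'i \<Rightarrow> complex" and I :: "'i set"
  assumes s: "0 < s" "s < 1" and fin: "finite I"
    and c: "\<And>i. i \<in> I \<Longrightarrow> 0 \<le> c i" and unit: "\<And>i. i \<in> I \<Longrightarrow> cmod (\<zeta> i) = 1"
begin

lemma has_field_derivative_outer_fun:
  assumes "cmod z < 1"
  shows "(outer_fun s c \<zeta> I has_field_derivative
    - outer_fun s c \<zeta> I z * (\<Sum>i\<in>I. of_real (c i) *
      (of_real s * boundary_log (\<zeta> i) z powr of_real (s - 1) * (cnj (\<zeta> i) / (1 - cnj (\<zeta> i) * z))))) (at z)"
proof -
  have "((\<lambda>z. \<Sum>i\<in>I. of_real (c i) * boundary_log (\<zeta> i) z powr of_real s) has_field_derivative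
    (\<Sum>i\<in>I. of_real (c i) *
      (of_real s * boundary_log (\<zeta> i) z powr of_real (s - 1) * (cnj (\<zeta> i) / (1 - cnj (\<zeta> i) * z))))) (at z)"
    using unit assms by (intro DERIV_sum DERIV_cmult has_field_derivative_boundary_log_powr)
  from DERIV_chain2[OF DERIV_exp DERIV_minus[OF this]]
  show ?thesis by (simp add: outer_fun_def[abs_def])
qed

lemma holomorphic_outer_fun: "outer_fun s c \<zeta> I holomorphic_on ball 0 1"
  unfolding holomorphic_on_open[OF open_ball]
  using has_field_derivative_outer_fun by (meson mem_ball_0)

lemma cmod_outer_fun_le:
  assumes "cmod z < 1"
  shows "cmod (outer_fun s c \<zeta> I z)
     \<le> exp (- (cos (s * (pi / 2)) * (\<Sum>i\<in>I. c i * cmod (boundary_log (\<zeta> i) z) powr s)))"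
proof -
  have "cos (s * (pi / 2)) * (\<Sum>i\<in>I. c i * cmod (boundary_log (\<zeta> i) z) powr s)
     \<le> (\<Sum>i\<in>I. c i * Re (boundary_log (\<zeta> i) z powr of_real s))"
    unfolding sum_distrib_left
  proof (rule sum_mono)
    fix i assume i: "i \<in> I"
    have "c i * (cos (s * (pi / 2)) * cmod (boundary_log (\<zeta> i) z) powr s)
       \<le> c i * Re (boundary_log (\<zeta> i) z powr of_real s)"
      using s by (intro mult_left_mono c i Re_boundary_log_powr_ge unit assms) auto
    thus "cos (s * (pi / 2)) * (c i * cmod (boundary_log (\<zeta> i) z) powr s)
       \<le> c i * Re (boundary_log (\<zeta> i) z powr of_real s)" by (simp add: mult_ac)
  qed
  thus ?thesis by (simp add: outer_fun_def)
qed

lemma cos_half_pi_pos: "0 < cos (s * (pi / 2))"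
proof (rule cos_gt_zero)
  show "s * (pi / 2) < pi / 2" using s mult_strict_right_mono[of s 1 "pi/2"] by simp
qed (use s in simp)

text \<open>All terms of the exponent are nonnegative in real part after the preceding estimate, so
  the singularity at one point makes the function small there whatever the other points are.\<close>

lemma cmod_outer_fun_le_term:
  assumes "cmod z < 1" "i \<in> I"
  shows "cmod (outer_fun s c \<zeta> I z)
     \<le> exp (- (cos (s * (pi / 2)) * (c i * cmod (boundary_log (\<zeta> i) z) powr s)))"
proof -
  have "c i * cmod (boundary_log (\<zeta> i) z) powr s
     \<le> (\<Sum>i\<in>I. c i * cmod (boundary_log (\<zeta> i) z) powr s)"
    using fin assms c by (intro member_le_sum) auto
  hence "cos (s * (pi / 2)) * (c i * cmod (boundary_log (\<zeta> i) z) powr s)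
     \<le> cos (s * (pi / 2)) * (\<Sum>i\<in>I. c i * cmod (boundary_log (\<zeta> i) z) powr s)"
    using cos_half_pi_pos by (intro mult_left_mono) auto
  thus ?thesis using cmod_outer_fun_le[OF assms(1)] by (smt (verit) exp_le_cancel_iff)
qed

lemma cmod_outer_fun_le_1:
  assumes "cmod z < 1"
  shows "cmod (outer_fun s c \<zeta> I z) \<le> 1"
proof -
  have "0 \<le> cos (s * (pi / 2)) * (\<Sum>i\<in>I. c i * cmod (boundary_log (\<zeta> i) z) powr s)"
    using cos_half_pi_pos c by (intro mult_nonneg_nonneg sum_nonneg) auto
  thus ?thesis using cmod_outer_fun_le[OF assms] by (smt (verit) exp_le_one_iff)
qed

lemma cmod_outer_fun_ge:
  assumes "cmod z < 1"
  shows "exp (- (\<Sum>i\<in>I. c i * cmod (boundary_log (\<zeta> i) z) powr s)) \<le> cmod (outer_fun s c \<zeta> I z)"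
proof -
  have "(\<Sum>i\<in>I. c i * Re (boundary_log (\<zeta> i) z powr of_real s))
     \<le> (\<Sum>i\<in>I. c i * cmod (boundary_log (\<zeta> i) z) powr s)"
  proof (intro sum_mono mult_left_mono c)
    fix i assume i: "i \<in> I"
    show "Re (boundary_log (\<zeta> i) z powr of_real s) \<le> cmod (boundary_log (\<zeta> i) z) powr s"
      using complex_Re_le_cmod[of "boundary_log (\<zeta> i) z powr of_real s"]
        cmod_boundary_log_powr[OF unit[OF i] assms] by simp
  qed
  thus ?thesis by (simp add: outer_fun_def)
qed

text \<open>Applying Cauchy--Schwarz with the weights \<open>c i * cmod (boundary_log (\<zeta> i) z) powr s\<close>
  lets the decay of the function absorb their sum. The resulting bound is linear in \<open>c\<close>.\<close>

lemma cmod_deriv_outer_fun_le: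
  assumes z: "cmod z < 1"
  shows "(cmod (deriv (outer_fun s c \<zeta> I) z))\<^sup>2
    \<le> (\<Sum>i\<in>I. c i * (ln (4 / cmod (z - \<zeta> i)) powr (s - 2) / (cmod (z - \<zeta> i))\<^sup>2))
        / (2 * cos (s * (pi / 2)))"
proof -
  define l where "l i = cmod (boundary_log (\<zeta> i) z)" for i
  define u where "u i = cmod (z - \<zeta> i)" for i
  define \<kappa> where "\<kappa> = cos (s * (pi / 2))"
  define X where "X = (\<Sum>i\<in>I. c i * l i powr s)"
  define Y where "Y = (\<Sum>i\<in>I. c i * (l i powr (s - 2) / (u i)\<^sup>2))"
  have powr_sq: "(x powr t)\<^sup>2 = x powr (2 * t)" for x t :: real
    by (simp add: power2_eq_square powr_add[symmetric])
  have \<kappa>: "0 < \<kappa>" unfolding \<kappa>_def by (rule cos_half_pi_pos)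
  have X0: "0 \<le> X" and Y0: "0 \<le> Y" unfolding X_def Y_def using c by (auto intro!: sum_nonneg)
  have lpos: "0 < l i" if "i \<in> I" for i
    using Re_boundary_log_pos[OF unit[OF that] z] by (auto simp: l_def)
  have lge: "ln (4 / u i) \<le> l i" "0 < ln (4 / u i)" if "i \<in> I" for i
    using cmod_boundary_log_ge[OF unit[OF that] z] Re_boundary_log_pos[OF unit[OF that] z]
    by (simp_all add: l_def u_def Re_boundary_log[OF unit[OF that] z])
  let ?S = "\<Sum>i\<in>I. of_real (c i) *
      (of_real s * boundary_log (\<zeta> i) z powr of_real (s - 1) * (cnj (\<zeta> i) / (1 - cnj (\<zeta> i) * z)))"
  have "cmod ?S \<le> (\<Sum>i\<in>I. c i * (l i powr (s - 1) / u i))"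
  proof (rule sum_norm_le)
    fix i assume i: "i \<in> I"
    have "cmod (of_real (c i) * (of_real s * boundary_log (\<zeta> i) z powr of_real (s - 1)
        * (cnj (\<zeta> i) / (1 - cnj (\<zeta> i) * z)))) = c i * (s * (l i powr (s - 1) / u i))"
      unfolding norm_mult norm_divide cmod_boundary_log_powr[OF unit[OF i] z]
        cmod_one_minus_cnj_mult[OF unit[OF i] z] l_def u_def
      using s c i unit by simp
    also have "\<dots> \<le> c i * (1 * (l i powr (s - 1) / u i))"
      using s c i by (intro mult_left_mono mult_right_mono) (auto simp: u_def)
    finally show "cmod (of_real (c i) * (of_real s * boundary_log (\<zeta> i) z powr of_real (s - 1)
        * (cnj (\<zeta> i) / (1 - cnj (\<zeta> i) * z)))) \<le> c i * (l i powr (s - 1) / u i)" by simp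
  qed
  hence "(cmod ?S)\<^sup>2 \<le> (\<Sum>i\<in>I. c i * (l i powr (s - 1) / u i))\<^sup>2"
    by (intro power_mono) auto
  \<comment> \<open>The exponent s - 1 is split as s/2 + (s/2 - 1). The first half squares to the
    sum \<open>X\<close> that also governs the decay of the function, the second to the integrable
    power s - 2.\<close>
  also have "(\<Sum>i\<in>I. c i * (l i powr (s - 1) / u i))
     = (\<Sum>i\<in>I. (sqrt (c i) * l i powr (s / 2)) * (sqrt (c i) * (l i powr (s / 2 - 1) / u i)))"
  proof (rule sum.cong[OF refl])
    fix i assume i: "i \<in> I"
    have "l i powr (s / 2) * l i powr (s / 2 - 1) = l i powr (s - 1)"
      by (simp add: powr_add[symmetric])
    moreover have "(sqrt (c i) * l i powr (s / 2)) * (sqrt (c i) * (l i powr (s / 2 - 1) / u i))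
      = (sqrt (c i) * sqrt (c i)) * (l i powr (s / 2) * l i powr (s / 2 - 1)) / u i" by simp
    moreover have "sqrt (c i) * sqrt (c i) = c i" using c[OF i] by simp
    ultimately show "c i * (l i powr (s - 1) / u i)
      = (sqrt (c i) * l i powr (s / 2)) * (sqrt (c i) * (l i powr (s / 2 - 1) / u i))"
      by (simp only: times_divide_eq_right)
  qed
  also have "(\<Sum>i\<in>I. (sqrt (c i) * l i powr (s / 2)) * (sqrt (c i) * (l i powr (s / 2 - 1) / u i)))\<^sup>2
     \<le> (\<Sum>i\<in>I. (sqrt (c i) * l i powr (s / 2))\<^sup>2)
       * (\<Sum>i\<in>I. (sqrt (c i) * (l i powr (s / 2 - 1) / u i))\<^sup>2)"
    by (rule Cauchy_Schwarz_ineq_sum)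
  also have "(\<Sum>i\<in>I. (sqrt (c i) * l i powr (s / 2))\<^sup>2) = X"
    unfolding X_def using c by (intro sum.cong refl) (simp add: power_mult_distrib powr_sq)
  also have "(\<Sum>i\<in>I. (sqrt (c i) * (l i powr (s / 2 - 1) / u i))\<^sup>2) = Y"
    unfolding Y_def using c
    by (intro sum.cong refl) (simp add: power_mult_distrib power_divide powr_sq right_diff_distrib)
  finally have S: "(cmod ?S)\<^sup>2 \<le> X * Y" .
  have "(cmod (outer_fun s c \<zeta> I z))\<^sup>2 \<le> (exp (- (\<kappa> * X)))\<^sup>2"
    using cmod_outer_fun_le[OF z] unfolding \<kappa>_def X_def l_def by (intro power_mono) auto
  also have "\<dots> = exp (- (2 * \<kappa> * X))" by (simp add: power2_eq_square exp_add[symmetric])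
  finally have "(cmod (outer_fun s c \<zeta> I z))\<^sup>2 * (cmod ?S)\<^sup>2 \<le> exp (- (2 * \<kappa> * X)) * (X * Y)"
    using S by (intro mult_mono) auto
  \<comment> \<open>This exposes t * exp (-t) with t = \<open>2 * \<kappa> * X\<close>, which is at
    most 1 however large \<open>X\<close> is.\<close>
  also have "exp (- (2 * \<kappa> * X)) * (X * Y) = (2 * \<kappa> * X * exp (- (2 * \<kappa> * X))) * Y / (2 * \<kappa>)"
    using \<kappa> by simp
  also have "\<dots> \<le> 1 * Y / (2 * \<kappa>)"
  proof -
    have "2 * \<kappa> * X \<le> exp (2 * \<kappa> * X)"
      using exp_ge_add_one_self[of "2 * \<kappa> * X"] by linarith
    hence "2 * \<kappa> * X * exp (- (2 * \<kappa> * X)) \<le> 1" by (simp add: exp_minus divide_inverse[symmetric])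
    thus ?thesis using Y0 \<kappa> by (intro divide_right_mono mult_right_mono) auto
  qed
  \<comment> \<open>The exponent s - 2 is negative, so passing from \<open>l i\<close> to the
    smaller real part increases each term.\<close>
  also have "Y \<le> (\<Sum>i\<in>I. c i * (ln (4 / u i) powr (s - 2) / (u i)\<^sup>2))"
    unfolding Y_def using s lge
    by (intro sum_mono mult_left_mono divide_right_mono powr_mono2' c) auto
  hence "1 * Y / (2 * \<kappa>) \<le> (\<Sum>i\<in>I. c i * (ln (4 / u i) powr (s - 2) / (u i)\<^sup>2)) / (2 * \<kappa>)"
    using \<kappa> by (simp add: divide_right_mono)
  finally have "(cmod (outer_fun s c \<zeta> I z))\<^sup>2 * (cmod ?S)\<^sup>2
     \<le> (\<Sum>i\<in>I. c i * (ln (4 / u i) powr (s - 2) / (u i)\<^sup>2)) / (2 * \<kappa>)" .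
  thus ?thesis
    unfolding DERIV_imp_deriv[OF has_field_derivative_outer_fun[OF z]] u_def \<kappa>_def
    by (simp add: norm_mult power_mult_distrib)
qed

end

text \<open>The constant depends on \<open>s\<close> alone, since the kernel bound is the same for
  every \<zeta> and the derivative estimate is linear in \<open>c\<close>. This uniformity is what
  allows finite subfamilies to exhaust an infinite family.\<close>

lemma outer_fun_dirichlet_bound:
  assumes s: "0 < s" "s < 1"
  obtains C where "0 \<le> C"
    "\<And>(I :: 'i set) c \<zeta>. finite I \<Longrightarrow> (\<And>i. i \<in> I \<Longrightarrow> 0 \<le> c i) \<Longrightarrow> (\<And>i. i \<in> I \<Longrightarrow> cmod (\<zeta> i) = 1)
      \<Longrightarrow> (\<integral>\<^sup>+ z. ennreal ((cmod (deriv (outer_fun s c \<zeta> I) z))\<^sup>2) \<partial>disk_area_measure)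
          \<le> ennreal (C * (\<Sum>i\<in>I. c i))"
proof -
  obtain C where C: "0 \<le> C"
    "\<And>\<zeta>. (\<integral>\<^sup>+ z. ennreal (ln (4 / cmod (z - \<zeta>)) powr (s - 2) / (cmod (z - \<zeta>))\<^sup>2)
        * indicator (ball \<zeta> 2 - {\<zeta>}) z \<partial>lborel) \<le> ennreal C"
    using nn_integral_log_kernel_bound[OF s(2)] by blast
  define \<kappa> where "\<kappa> = cos (s * (pi / 2))"
  define K where "K = C / (2 * \<kappa>)"
  have \<kappa>: "0 < \<kappa>"
    using cos_half_pi_pos[of s "{}" "\<lambda>_. 0" "\<lambda>_. 1"] s by (simp add: \<kappa>_def)
  show ?thesis
  proof
    show "0 \<le> K / pi" using C \<kappa> by (simp add: K_def)
    fix I :: "'i set" and c :: "'i \<Rightarrow> real" and \<zeta> :: "'i \<Rightarrow> complex"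
    assume fin: "finite I" and c: "\<And>i. i \<in> I \<Longrightarrow> 0 \<le> c i" and unit: "\<And>i. i \<in> I \<Longrightarrow> cmod (\<zeta> i) = 1"
    define k where "k i z = ennreal (ln (4 / cmod (z - \<zeta> i)) powr (s - 2) / (cmod (z - \<zeta> i))\<^sup>2)
        * indicator (ball (\<zeta> i) 2 - {\<zeta> i}) z" for i z
    have k_meas: "k i \<in> borel_measurable borel" for i
      unfolding k_def
      by (intro borel_measurable_times_ennreal borel_measurable_indicator) (measurable, auto)
    have d: "deriv (outer_fun s c \<zeta> I) holomorphic_on ball 0 1"
      using holomorphic_outer_fun[of s I c \<zeta>] s fin c unit by (intro holomorphic_deriv) auto
    have "(\<integral>\<^sup>+ z. ennreal ((cmod (deriv (outer_fun s c \<zeta> I) z))\<^sup>2) * indicator (ball 0 1) z \<partial>lborel)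
      \<le> (\<integral>\<^sup>+ z. (\<Sum>i\<in>I. ennreal (c i / (2 * \<kappa>)) * k i z) \<partial>lborel)"
    proof (rule nn_integral_mono)
      fix z :: complex
      show "ennreal ((cmod (deriv (outer_fun s c \<zeta> I) z))\<^sup>2) * indicator (ball 0 1) z
        \<le> (\<Sum>i\<in>I. ennreal (c i / (2 * \<kappa>)) * k i z)"
      proof (cases "z \<in> ball 0 1")
        case True
        hence z: "cmod z < 1" by simp
        have "ennreal ((cmod (deriv (outer_fun s c \<zeta> I) z))\<^sup>2)
          \<le> ennreal (\<Sum>i\<in>I. c i / (2 * \<kappa>) * (ln (4 / cmod (z - \<zeta> i)) powr (s - 2) / (cmod (z - \<zeta> i))\<^sup>2))"
          using cmod_deriv_outer_fun_le[of s I c \<zeta>, OF s fin c unit z]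
          by (intro ennreal_leI) (simp add: \<kappa>_def sum_divide_distrib mult_ac)
        also have "\<dots> = (\<Sum>i\<in>I. ennreal (c i / (2 * \<kappa>) * (ln (4 / cmod (z - \<zeta> i)) powr (s - 2) / (cmod (z - \<zeta> i))\<^sup>2)))"
          using c \<kappa> by (intro sum_ennreal[symmetric]) auto
        also have "\<dots> = (\<Sum>i\<in>I. ennreal (c i / (2 * \<kappa>)) * k i z)"
        proof (rule sum.cong[OF refl])
          fix i assume i: "i \<in> I"
          have "z \<in> ball (\<zeta> i) 2 - {\<zeta> i}"
            using dist_unit_bounds[OF unit[OF i] z] by (auto simp: dist_norm norm_minus_commute)
          thus "ennreal (c i / (2 * \<kappa>) * (ln (4 / cmod (z - \<zeta> i)) powr (s - 2) / (cmod (z - \<zeta> i))\<^sup>2))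
            = ennreal (c i / (2 * \<kappa>)) * k i z"
            using c[OF i] \<kappa> unfolding k_def by (subst ennreal_mult') simp_all
        qed
        finally show ?thesis using True by simp
      qed simp
    qed
    also have "\<dots> = (\<Sum>i\<in>I. ennreal (c i / (2 * \<kappa>)) * (\<integral>\<^sup>+ z. k i z \<partial>lborel))"
      by (subst nn_integral_sum) (auto intro!: borel_measurable_times_ennreal simp: nn_integral_cmult k_meas)
    also have "\<dots> \<le> (\<Sum>i\<in>I. ennreal (c i / (2 * \<kappa>)) * ennreal C)"
      unfolding k_def by (intro sum_mono mult_left_mono C) auto
    also have "\<dots> = (\<Sum>i\<in>I. ennreal (c i * K))"
      using c C \<kappa> by (intro sum.cong refl) (simp add: ennreal_mult''[symmetric] K_def)
    also have "\<dots> = ennreal (K * (\<Sum>i\<in>I. c i))"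
      using c C \<kappa> by (subst sum_ennreal) (auto simp: K_def sum_distrib_left sum_divide_distrib mult.commute)
    finally have "(\<integral>\<^sup>+ z. ennreal ((cmod (deriv (outer_fun s c \<zeta> I) z))\<^sup>2) * indicator (ball 0 1) z \<partial>lborel)
        / ennreal pi \<le> ennreal (K * (\<Sum>i\<in>I. c i)) / ennreal pi"
      by (rule divide_right_mono_ennreal)
    also have "\<dots> = ennreal (K / pi * (\<Sum>i\<in>I. c i))"
      using c C \<kappa> by (subst divide_ennreal) (auto simp: K_def intro!: divide_nonneg_nonneg mult_nonneg_nonneg sum_nonneg)
    finally show "(\<integral>\<^sup>+ z. ennreal ((cmod (deriv (outer_fun s c \<zeta> I) z))\<^sup>2) \<partial>disk_area_measure)
          \<le> ennreal (K / pi * (\<Sum>i\<in>I. c i))"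
      unfolding nn_integral_disk_area_measure[OF d] .
  qed
qed

section \<open>Poisson integrals at the zeros and passage to the limit\<close>

lemma cmod_minus_cnj_mult_square:
  "(cmod (1 - cnj a * w))\<^sup>2 = (cmod (w - a))\<^sup>2 + (1 - (cmod a)\<^sup>2) * (1 - (cmod w)\<^sup>2)"
  using cmod_diff_blaschke_coeffs[of w a 1] by (simp add: algebra_simps)

lemma cmod_minus_le_cmod_one_minus_cnj:
  assumes "cmod a < 1" "cmod w < 1"
  shows "cmod (w - a) \<le> cmod (1 - cnj a * w)"
proof (rule power2_le_imp_le)
  have "0 \<le> (1 - (cmod a)\<^sup>2) * (1 - (cmod w)\<^sup>2)"
    using assms by (intro mult_nonneg_nonneg) (auto simp: power_le_one less_imp_le)
  thus "(cmod (w - a))\<^sup>2 \<le> (cmod (1 - cnj a * w))\<^sup>2"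
    unfolding cmod_minus_cnj_mult_square by simp
qed simp

lemma cmod_blaschke_prod_le_1:
  assumes "A \<subseteq> ball 0 1" "cmod z < 1"
  shows "cmod (blaschke_prod A z) \<le> 1"
  unfolding blaschke_prod_def prod_norm[symmetric]
proof (rule prod_le_1)
  fix a assume "a \<in> A"
  thus "0 \<le> cmod ((z - a) / (1 - cnj a * z)) \<and> cmod ((z - a) / (1 - cnj a * z)) \<le> 1"
    using assms cmod_minus_le_cmod_one_minus_cnj[of a z]
    by (auto simp: norm_divide intro!: divide_le_eq_1[THEN iffD2])
qed

text \<open>A factor has squared modulus 1 / (1 + q/p) \<ge> exp (-q/p), with p = |z - a|^2 and q =
  (1 - |a|^2) * (1 - |z|^2). The bound sees \<open>A\<close> only through \<open>r\<close> and the
  Blaschke sum, so it is uniform over finite subproducts.\<close>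

lemma cmod_blaschke_prod_ge:
  assumes A: "finite A" "A \<subseteq> ball 0 1" and z: "cmod z < 1" and r: "0 < r"
    and far: "\<And>a. a \<in> A \<Longrightarrow> r \<le> cmod (z - a)"
  shows "exp (- (\<Sum>a\<in>A. 1 - (cmod a)\<^sup>2) / r\<^sup>2) \<le> (cmod (blaschke_prod A z))\<^sup>2"
proof -
  have factor: "exp (- (1 - (cmod a)\<^sup>2) / r\<^sup>2) \<le> (cmod ((z - a) / (1 - cnj a * z)))\<^sup>2" if a: "a \<in> A" for a
  proof -
    define p where "p = (cmod (z - a))\<^sup>2"
    define q where "q = (1 - (cmod a)\<^sup>2) * (1 - (cmod z)\<^sup>2)"
    have a1: "(cmod a)\<^sup>2 \<le> 1" "(cmod z)\<^sup>2 \<le> 1" using a A z by (auto simp: power_le_one less_imp_le)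
    have rp: "r\<^sup>2 \<le> p" unfolding p_def using far[OF a] r by (intro power_mono) auto
    have r2: "0 < r\<^sup>2" using r by simp
    hence p: "0 < p" using rp by linarith
    have q: "0 \<le> q" "q \<le> 1 - (cmod a)\<^sup>2"
      using a1 by (auto simp: q_def intro!: mult_left_le)
    have "q / p \<le> (1 - (cmod a)\<^sup>2) / r\<^sup>2" using q rp r2 a1 by (intro frac_le) auto
    hence "exp (- (1 - (cmod a)\<^sup>2) / r\<^sup>2) \<le> exp (- (q / p))"
      by (simp only: exp_le_cancel_iff minus_divide_left[symmetric] neg_le_iff_le)
    also have "\<dots> = 1 / exp (q / p)" by (simp add: exp_minus field_simps)
    also have "\<dots> \<le> 1 / (1 + q / p)"
      using q p exp_ge_add_one_self[of "q / p"] by (intro divide_left_mono) (auto intro!: mult_pos_pos add_pos_nonneg)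
    also have "\<dots> = p / (p + q)" using p by (simp add: field_simps)
    also have "\<dots> = (cmod ((z - a) / (1 - cnj a * z)))\<^sup>2"
      by (simp add: norm_divide power_divide cmod_minus_cnj_mult_square p_def q_def)
    finally show ?thesis .
  qed
  have "exp (- (\<Sum>a\<in>A. 1 - (cmod a)\<^sup>2) / r\<^sup>2) = (\<Prod>a\<in>A. exp (- (1 - (cmod a)\<^sup>2) / r\<^sup>2))"
    unfolding exp_sum[OF A(1), symmetric] sum_divide_distrib[symmetric] sum_negf ..
  also have "\<dots> \<le> (\<Prod>a\<in>A. (cmod ((z - a) / (1 - cnj a * z)))\<^sup>2)"
    using factor by (intro prod_mono) auto
  also have "\<dots> = (cmod (blaschke_prod A z))\<^sup>2"
    by (simp add: blaschke_prod_def prod_norm[symmetric] prod_power_distrib)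
  finally show ?thesis .
qed

text \<open>Near \<open>\<zeta>\<close> the smallness of \<open>F\<close> is used; away from \<open>\<zeta>\<close> the Poisson kernel at \<open>a\<close> is at most \<open>4 (1 - (cmod a)\<^sup>2) / \<rho>\<^sup>2\<close>.\<close>

lemma hardy_partial_cauchy_kernel_near:
  assumes F: "F holomorphic_on ball 0 1" and F1: "\<And>w. cmod w < 1 \<Longrightarrow> cmod (F w) \<le> 1"
    and near: "\<And>w. cmod w < 1 \<Longrightarrow> cmod (w - \<zeta>) < \<rho> \<Longrightarrow> (cmod (F w))\<^sup>2 \<le> \<epsilon>"
    and a: "cmod a < 1" "cmod (a - \<zeta>) \<le> \<rho> / 2" and pos: "0 < \<rho>" "0 \<le> \<epsilon>"
  shows "(1 - (cmod a)\<^sup>2)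
      * hardy_partial (fps_expansion F 0 * inverse (1 - fps_const (cnj a) * fps_X)) N
    \<le> \<epsilon> + 4 / \<rho>\<^sup>2 * (1 - (cmod a)\<^sup>2)"
proof (rule hardy_partial_cauchy_kernel_le[OF F a(1)])
  fix w :: complex assume w: "cmod w < 1"
  show "(cmod (F w))\<^sup>2 / (cmod (1 - cnj a * w))\<^sup>2 \<le> \<epsilon> / (cmod (1 - cnj a * w))\<^sup>2 + 4 / \<rho>\<^sup>2"
  proof (cases "cmod (w - \<zeta>) < \<rho>")
    case True
    from near[OF w this] have "(cmod (F w))\<^sup>2 / (cmod (1 - cnj a * w))\<^sup>2 \<le> \<epsilon> / (cmod (1 - cnj a * w))\<^sup>2"
      by (rule divide_right_mono) simp
    thus ?thesis using pos by (simp add: add_increasing2)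
  next
    case False
    have "cmod (w - \<zeta>) \<le> cmod (w - a) + cmod (a - \<zeta>)" by norm
    hence "\<rho> / 2 \<le> cmod (1 - cnj a * w)"
      using False a(2) cmod_minus_le_cmod_one_minus_cnj[OF a(1) w] by linarith
    hence "(\<rho> / 2)\<^sup>2 \<le> (cmod (1 - cnj a * w))\<^sup>2" using pos by (intro power_mono) auto
    moreover have "(cmod (F w))\<^sup>2 \<le> 1" using F1[OF w] by (simp add: power_le_one)
    ultimately have "(cmod (F w))\<^sup>2 / (cmod (1 - cnj a * w))\<^sup>2 \<le> 1 / (\<rho> / 2)\<^sup>2"
      using pos by (intro frac_le) auto
    also have "\<dots> = 4 / \<rho>\<^sup>2" by (simp add: power_divide)
    finally show ?thesis using pos by (simp add: add_increasing)
  qed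
qed (use pos in auto)

text \<open>The Poisson integral of a function bounded by 1 is at most 1. This serves the regions
  not close enough to the circle for the asymptotic comparison.\<close>

lemma hardy_partial_cauchy_kernel_le_1:
  assumes F: "F holomorphic_on ball 0 1" and F1: "\<And>w. cmod w < 1 \<Longrightarrow> cmod (F w) \<le> 1"
    and a: "cmod a < 1"
  shows "(1 - (cmod a)\<^sup>2)
      * hardy_partial (fps_expansion F 0 * inverse (1 - fps_const (cnj a) * fps_X)) N \<le> 1"
proof -
  have "(cmod (F w))\<^sup>2 / (cmod (1 - cnj a * w))\<^sup>2 \<le> 1 / (cmod (1 - cnj a * w))\<^sup>2 + 0"
    if "cmod w < 1" for w
    using F1[OF that] by (simp add: divide_right_mono power_le_one)
  from hardy_partial_cauchy_kernel_le[OF F a _ _ this, of N] show ?thesis by simp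
qed

text \<open>The lower bound at the fixed point \<open>z0\<close> keeps the limit from vanishing
  identically. Zeros need to be present only eventually, since each one is then a zero of the
  pointwise limit.\<close>

lemma dirichlet_zero_setI:
  fixes f :: "nat \<Rightarrow> complex \<Rightarrow> complex"
  assumes Z: "Z \<subseteq> ball 0 1"
    and hol: "\<And>n. f n holomorphic_on ball 0 1"
    and bounded: "\<And>n z. cmod z < 1 \<Longrightarrow> cmod (f n z) \<le> 1"
    and energy: "\<And>n. (\<integral>\<^sup>+ z. ennreal ((cmod (deriv (f n) z))\<^sup>2) \<partial>disk_area_measure) \<le> ennreal M"
    and zero: "\<And>z. z \<in> Z \<Longrightarrow> \<forall>\<^sub>F n in sequentially. f n z = 0"
    and z0: "cmod z0 < 1" "0 < m" "\<And>n. m \<le> cmod (f n z0)"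
  shows "dirichlet_zero_set Z"
proof -
  obtain g r where g: "g holomorphic_on ball 0 1" and r: "strict_mono (r :: nat \<Rightarrow> nat)"
    and lim: "\<And>x. x \<in> ball 0 1 \<Longrightarrow> (\<lambda>n. f (r n) x) \<longlonglongrightarrow> g x"
    and unif: "\<And>K. compact K \<Longrightarrow> K \<subseteq> ball 0 1 \<Longrightarrow> uniform_limit K (f \<circ> r) g sequentially"
  proof (rule Montel[of "ball 0 1" "range f" f])
    show "\<exists>B. \<forall>h\<in>range f. \<forall>z\<in>K. cmod (h z) \<le> B" if "K \<subseteq> ball 0 1" for K
      using bounded that by (intro exI[of _ 1]) auto
  qed (use hol in auto)
  define u where "u h z = ennreal ((cmod (deriv h z))\<^sup>2) * indicator (ball 0 1) z" for h z
  have dhol: "deriv (f n) holomorphic_on ball 0 1" "deriv g holomorphic_on ball 0 1" for n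
    using hol g by (auto intro!: holomorphic_deriv)
  have u_lim: "(\<lambda>n. u (f (r n)) z) \<longlonglongrightarrow> u g z" for z
  proof (cases "cmod z < 1")
    case True
    hence "z \<in> ball 0 1" by simp
    then obtain d where d: "0 < d" "cball z d \<subseteq> ball 0 1"
      using open_ball[of "0::complex" 1] unfolding open_contains_cball by blast
    have ul: "uniform_limit (ball z d) (f \<circ> r) g sequentially"
      using unif[OF compact_cball d(2)] by (rule uniform_limit_on_subset) auto
    have sub: "ball z d \<subseteq> ball 0 1" using d(2) ball_subset_cball by blast
    have "(\<lambda>n. deriv ((f \<circ> r) n) z) \<longlonglongrightarrow> deriv g z"
    proof (rule deriv_complex_uniform_limit[OF ul])
      show "\<forall>\<^sub>F n in sequentially. (f \<circ> r) n holomorphic_on ball z d"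
        unfolding o_def by (intro always_eventually allI holomorphic_on_subset[OF hol sub])
    qed (use d in auto)
    hence "(\<lambda>n. ennreal ((cmod (deriv (f (r n)) z))\<^sup>2)) \<longlonglongrightarrow> ennreal ((cmod (deriv g z))\<^sup>2)"
      by (intro tendsto_ennrealI tendsto_intros) (simp add: o_def)
    thus ?thesis using True by (simp add: u_def)
  qed (simp add: u_def)
  have "(\<integral>\<^sup>+ z. u g z \<partial>lborel) = (\<integral>\<^sup>+ z. liminf (\<lambda>n. u (f (r n)) z) \<partial>lborel)"
    using u_lim by (intro nn_integral_cong lim_imp_Liminf[symmetric]) auto
  also have "\<dots> \<le> liminf (\<lambda>n. \<integral>\<^sup>+ z. u (f (r n)) z \<partial>lborel)"
    unfolding u_def using borel_measurable_norm_square_disk[OF dhol(1)]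
    by (intro nn_integral_liminf) simp
  also have "\<dots> \<le> liminf (\<lambda>n::nat. ennreal M * ennreal pi)"
  proof (intro Liminf_mono always_eventually allI)
    fix n
    have "(\<integral>\<^sup>+ z. u (f (r n)) z \<partial>lborel) / ennreal pi \<le> ennreal M"
      using energy[of "r n"] unfolding nn_integral_disk_area_measure[OF dhol(1)] u_def .
    hence "(\<integral>\<^sup>+ z. u (f (r n)) z \<partial>lborel) / ennreal pi * ennreal pi \<le> ennreal M * ennreal pi"
      by (rule mult_right_mono) simp
    moreover have "ennreal pi / ennreal pi = 1"
      by (intro ennreal_divide_self) (simp_all add: ennreal_eq_0_iff not_le)
    ultimately show "(\<integral>\<^sup>+ z. u (f (r n)) z \<partial>lborel) \<le> ennreal M * ennreal pi"
      by (simp only: ennreal_divide_times mult_1_right)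
  qed
  also have "\<dots> = ennreal M * ennreal pi" by (simp add: Liminf_const)
  also have "\<dots> < \<infinity>" by (simp add: ennreal_mult_less_top)
  finally have fin: "(\<integral>\<^sup>+ z. u g z \<partial>lborel) < \<infinity>" .
  have "(\<integral>\<^sup>+ z. ennreal ((cmod (deriv g z))\<^sup>2) \<partial>disk_area_measure) < \<infinity>"
    unfolding nn_integral_disk_area_measure[OF dhol(2)] u_def[symmetric]
    using fin
    by (simp add: less_top[symmetric] ennreal_divide_eq_top_iff ennreal_eq_0_iff not_le)
  hence "g \<in> dirichlet_space" using g by (simp add: dirichlet_space_def)
  moreover have "g z0 \<noteq> 0"
  proof -
    have "m \<le> cmod (g z0)"
      using z0 lim[of z0] by (intro tendsto_lowerbound[OF tendsto_norm]) auto
    thus ?thesis using z0 by auto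
  qed
  moreover have "g z = 0" if "z \<in> Z" for z
  proof (rule LIMSEQ_unique)
    show "(\<lambda>n. f (r n) z) \<longlonglongrightarrow> g z" using that Z by (intro lim) auto
    show "(\<lambda>n. f (r n) z) \<longlonglongrightarrow> 0"
      using eventually_subseq[OF r zero[OF that]] by (rule tendsto_eventually)
  qed
  ultimately show ?thesis
    using Z z0 unfolding dirichlet_zero_set_def by (auto intro!: bexI[of _ g] bexI[of _ z0])
qed

text \<open>The sets may overlap, as one zero can lie in several regions; nonnegativity of
  \<open>f\<close> makes repeated counting harmless.\<close>

lemma sum_UN_le_card:
  fixes f :: "'a \<Rightarrow> real" and e :: "'i \<Rightarrow> real"
  assumes "finite I" "\<And>i. i \<in> I \<Longrightarrow> finite (A i)"
    and "\<And>i a. i \<in> I \<Longrightarrow> a \<in> A i \<Longrightarrow> 0 \<le> f a" "\<And>i a. i \<in> I \<Longrightarrow> a \<in> A i \<Longrightarrow> f a \<le> e i"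
  shows "(\<Sum>a\<in>(\<Union>i\<in>I. A i). f a) \<le> (\<Sum>i\<in>I. real (card (A i)) * e i)"
  using assms
proof (induction I)
  case (insert i I)
  let ?U = "\<Union>i\<in>I. A i"
  have fin: "finite ?U" "finite (A i)" using insert by auto
  have "sum f (A i \<union> ?U) = sum f (A i) + sum f ?U - sum f (A i \<inter> ?U)"
    using fin by (intro sum.union_inter[THEN eq_diff_eq[THEN iffD2]])
  also have "\<dots> \<le> sum f (A i) + sum f ?U"
    using sum_nonneg[of "A i \<inter> ?U" f] insert.prems(2) by auto
  also have "sum f (A i) \<le> real (card (A i)) * e i"
    using insert.prems(3) by (intro sum_bounded_above) auto
  finally have "sum f (A i \<union> ?U) \<le> real (card (A i)) * e i + sum f ?U" by simp
  also have "sum f ?U \<le> (\<Sum>i\<in>I. real (card (A i)) * e i)"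
    using insert by (intro insert.IH) auto
  finally show ?case using insert.hyps by simp
qed simp

text \<open>Each point with |a| \<le> 1/2 contributes at least 3/4 to the Blaschke sum, so only
  finitely many exist and some small disc in |z| < 1/2 avoids them. The radius serves all of
  \<open>Z\<close>, hence every finite subproduct at once.\<close>

lemma exists_point_far_from_blaschke_set:
  fixes Z :: "complex set"
  assumes "\<And>A. finite A \<Longrightarrow> A \<subseteq> Z \<Longrightarrow> (\<Sum>a\<in>A. 1 - (cmod a)\<^sup>2) \<le> S"
  obtains z r where "cmod z < 1 / 2" "0 < r" "\<And>a. a \<in> Z \<Longrightarrow> r \<le> cmod (z - a)"
proof -
  define B where "B = Z \<inter> cball 0 (1 / 2)"
  have "finite B"
  proof (rule ccontr)
    assume "infinite B"
    obtain n :: nat where n: "S < real n * (3 / 4)"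
      using reals_Archimedean3[of "3 / 4 :: real"] by auto
    obtain A where A: "finite A" "card A = n" "A \<subseteq> B"
      using infinite_arbitrarily_large[OF \<open>infinite B\<close>] by blast
    have "real n * (3 / 4) \<le> (\<Sum>a\<in>A. 1 - (cmod a)\<^sup>2)"
      unfolding A(2)[symmetric]
    proof (rule sum_bounded_below)
      fix a assume "a \<in> A"
      hence "cmod a \<le> 1 / 2" using A by (auto simp: B_def)
      hence "(cmod a)\<^sup>2 \<le> (1 / 2)\<^sup>2" by (intro power_mono) auto
      thus "3 / 4 \<le> 1 - (cmod a)\<^sup>2" by (simp add: power2_eq_square)
    qed
    also have "\<dots> \<le> S" using A by (intro assms) (auto simp: B_def)
    finally show False using n by simp
  qed
  hence opn: "open (ball 0 (1 / 2) - B)" by (intro open_Diff open_ball finite_imp_closed)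
  have "ball (0::complex) (1 / 2) - B \<noteq> {}"
  proof
    assume "ball (0::complex) (1 / 2) - B = {}"
    hence "finite (ball (0::complex) (1 / 2))"
      by (simp add: finite_subset[OF _ \<open>finite B\<close>])
    thus False using finite_imp_not_open[of "ball (0::complex) (1/2)"] by simp
  qed
  then obtain z where z: "z \<in> ball 0 (1 / 2) - B" by blast
  obtain r where r: "0 < r" "ball z r \<subseteq> ball 0 (1 / 2) - B"
    using openE[OF opn z] by metis
  have "r \<le> cmod (z - a)" if "a \<in> Z" for a
  proof (rule ccontr)
    assume "\<not> r \<le> cmod (z - a)"
    hence "a \<in> ball z r" by (simp add: dist_norm)
    hence "a \<in> ball 0 (1 / 2) - B" using r(2) by blast
    thus False using that by (auto simp: B_def)
  qed
  thus ?thesis using that[of z r] z r by auto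
qed

section \<open>Size comparisons inside the regions\<close>

text \<open>Here x stands for log (1 / (1 - |l|)), so \<open>exp (- x) * x powr \<alpha>\<close> is
  the radius of the region. The first inequality puts the region within half of \<rho> = exp (-x/4).
  In the second, 8 * exp (x/2) is the tail factor 4 / \<rho>^2 times the 2 from 1 - |a|^2 \<le> 2 *
  |a - \<zeta>|.\<close>

lemma eventually_region_decay:
  fixes \<alpha> \<gamma> :: real
  assumes "\<gamma> < 1"
  shows "\<forall>\<^sub>F x in at_top. exp (- x) * x powr \<alpha> \<le> exp (- x / 4) / 2
     \<and> 8 * exp (x / 2) * (exp (- x) * x powr \<alpha>) \<le> exp (- (x powr \<gamma>))"
proof -
  have "((\<lambda>x. exp (- 3 * x / 4) * x powr \<alpha>) \<longlongrightarrow> 0) at_top" by real_asymp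
  hence 1: "\<forall>\<^sub>F x in at_top. exp (- 3 * x / 4) * x powr \<alpha> < 1 / 2"
    by (rule order_tendstoD) simp
  have "filterlim (\<lambda>x. x / 2 - \<alpha> * ln x - x powr \<gamma>) at_top at_top"
    using assms by real_asymp
  hence 2: "\<forall>\<^sub>F x in at_top. ln 8 \<le> x / 2 - \<alpha> * ln x - x powr \<gamma>"
    by (rule filterlim_at_top[THEN iffD1, rule_format])
  show ?thesis using 1 2 eventually_gt_at_top[of 0]
  proof eventually_elim
    case (elim x)
    have "exp (- x) = exp (- x / 4) * exp (- 3 * x / 4)" by (simp add: exp_add[symmetric])
    hence "exp (- x) * x powr \<alpha> = exp (- x / 4) * (exp (- 3 * x / 4) * x powr \<alpha>)" by simp
    also have "\<dots> \<le> exp (- x / 4) * (1 / 2)" using elim by (intro mult_left_mono) auto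
    finally have a: "exp (- x) * x powr \<alpha> \<le> exp (- x / 4) / 2" by simp
    have "8 * exp (x / 2) * (exp (- x) * x powr \<alpha>)
        = exp (ln 8) * exp (x / 2) * exp (- x) * exp (\<alpha> * ln x)"
      using elim by (simp add: powr_def)
    also have "\<dots> = exp (ln 8 + x / 2 + - x + \<alpha> * ln x)" by (simp only: exp_add)
    also have "\<dots> \<le> exp (- (x powr \<gamma>))" using elim by simp
    finally show ?case using a by simp
  qed
qed

text \<open>\<open>C\<close> is fixed before l, a, F and N. For large x the asymptotic comparison
  applies; for smaller x both left sides are at most 1 and the exponential on the right is bounded
  below. The first estimate leads to the Blaschke condition, the second bounds the energy added by
  each zero.\<close>

lemma S_region_estimate:
  fixes \<alpha> \<gamma> :: real
  assumes "0 < \<gamma>" "\<gamma> < 1"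
  obtains C where "0 \<le> C"
    "\<And>l a. l \<in> ball 0 1 - {0} \<Longrightarrow> a \<in> S_region l \<alpha> \<Longrightarrow>
       1 - (cmod a)\<^sup>2 \<le> C * exp (- (ln (1 / (1 - cmod l)) powr \<gamma>))"
    "\<And>l a F N. l \<in> ball 0 1 - {0} \<Longrightarrow> a \<in> S_region l \<alpha> \<Longrightarrow> F holomorphic_on ball 0 1 \<Longrightarrow>
       (\<And>w. cmod w < 1 \<Longrightarrow> cmod (F w) \<le> 1) \<Longrightarrow>
       (\<And>w. cmod w < 1 \<Longrightarrow> cmod (w - cis (Arg l)) < exp (- ln (1 / (1 - cmod l)) / 4) \<Longrightarrow>
          (cmod (F w))\<^sup>2 \<le> exp (- (ln (1 / (1 - cmod l)) powr \<gamma>))) \<Longrightarrow>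
       (1 - (cmod a)\<^sup>2)
         * hardy_partial (fps_expansion F 0 * inverse (1 - fps_const (cnj a) * fps_X)) N
       \<le> C * exp (- (ln (1 / (1 - cmod l)) powr \<gamma>))"
proof -
  obtain x0 where x0: "\<And>x. x0 \<le> x \<Longrightarrow> exp (- x) * x powr \<alpha> \<le> exp (- x / 4) / 2
     \<and> 8 * exp (x / 2) * (exp (- x) * x powr \<alpha>) \<le> exp (- (x powr \<gamma>))"
    using eventually_region_decay[OF assms(2), of \<alpha>] unfolding eventually_at_top_linorder by blast
  \<comment> \<open>The 2 collects the near part and the tail; the exponential covers 0 < x < x0,
    with \<open>max 0\<close> because \<open>x0\<close> may be negative.\<close>
  define C where "C = max 2 (exp (max 0 x0 powr \<gamma>))"
  have small: "1 \<le> C * exp (- (x powr \<gamma>))" if "0 < x" "x < x0" for x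
  proof -
    have "x powr \<gamma> \<le> max 0 x0 powr \<gamma>" using that assms by (intro powr_mono2) auto
    hence "1 \<le> exp (max 0 x0 powr \<gamma>) * exp (- (x powr \<gamma>))" by (simp add: exp_add[symmetric])
    also have "\<dots> \<le> C * exp (- (x powr \<gamma>))" by (intro mult_right_mono) (auto simp: C_def)
    finally show ?thesis .
  qed
  have large: "2 * exp (- (x powr \<gamma>)) \<le> C * exp (- (x powr \<gamma>))" for x
    by (intro mult_right_mono) (auto simp: C_def)
  have region: "cmod a < 1" "1 - (cmod a)\<^sup>2 \<le> 2 * cmod (a - cis (Arg l))"
      "cmod (a - cis (Arg l)) \<le> exp (- ln (1 / (1 - cmod l))) * ln (1 / (1 - cmod l)) powr \<alpha>"
      "0 < ln (1 / (1 - cmod l))"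
    if l: "l \<in> ball 0 1 - {0}" and a: "a \<in> S_region l \<alpha>" for l a
  proof -
    show a1: "cmod a < 1" using a by (simp add: S_region_def)
    have d: "0 < 1 - cmod l" "1 - cmod l < 1" using l by auto
    thus "0 < ln (1 / (1 - cmod l))" by (intro ln_gt_zero) (simp add: field_simps)
    have "exp (- ln (1 / (1 - cmod l))) = 1 - cmod l" using d by (simp add: ln_div)
    thus "cmod (a - cis (Arg l)) \<le> exp (- ln (1 / (1 - cmod l))) * ln (1 / (1 - cmod l)) powr \<alpha>"
      using a by (simp add: S_region_def)
    have "1 - (cmod a)\<^sup>2 = (1 + cmod a) * (1 - cmod a)" by (simp add: power2_eq_square algebra_simps)
    also have "\<dots> \<le> 2 * (1 - cmod a)" using a1 by (intro mult_right_mono) auto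
    also have "1 - cmod a \<le> cmod (a - cis (Arg l))"
      using norm_triangle_ineq2[of "cis (Arg l)" a] by (simp add: norm_minus_commute)
    finally show "1 - (cmod a)\<^sup>2 \<le> 2 * cmod (a - cis (Arg l))" by simp
  qed
  show ?thesis
  proof
    show "0 \<le> C" by (simp add: C_def)
    fix l a assume l: "l \<in> ball 0 1 - {0}" and a: "a \<in> S_region l \<alpha>"
    define x where "x = ln (1 / (1 - cmod l))"
    note reg = region[OF l a, folded x_def]
    show "1 - (cmod a)\<^sup>2 \<le> C * exp (- (ln (1 / (1 - cmod l)) powr \<gamma>))"
      unfolding x_def[symmetric]
    proof (cases "x < x0")
      case True
      have "1 - (cmod a)\<^sup>2 \<le> 1" by simp
      also have "\<dots> \<le> C * exp (- (x powr \<gamma>))" using True reg by (intro small) auto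
      finally show "1 - (cmod a)\<^sup>2 \<le> C * exp (- (x powr \<gamma>))" .
    next
      case False
      have "1 - (cmod a)\<^sup>2 \<le> 2 * (exp (- x) * x powr \<alpha>)" using reg by linarith
      also have "\<dots> \<le> 8 * exp (x / 2) * (exp (- x) * x powr \<alpha>)"
        using reg one_le_exp_iff[of "x / 2"] by (intro mult_right_mono) (linarith, auto)
      also have "\<dots> \<le> exp (- (x powr \<gamma>))" using x0[of x] False by auto
      also have "\<dots> \<le> C * exp (- (x powr \<gamma>))" using large[of x] by (smt (verit) exp_gt_zero)
      finally show "1 - (cmod a)\<^sup>2 \<le> C * exp (- (x powr \<gamma>))" .
    qed
    fix F N
    assume F: "F holomorphic_on ball 0 1" and F1: "\<And>w. cmod w < 1 \<Longrightarrow> cmod (F w) \<le> 1"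
      and near: "\<And>w. cmod w < 1 \<Longrightarrow> cmod (w - cis (Arg l)) < exp (- ln (1 / (1 - cmod l)) / 4) \<Longrightarrow>
          (cmod (F w))\<^sup>2 \<le> exp (- (ln (1 / (1 - cmod l)) powr \<gamma>))"
    let ?K = "(1 - (cmod a)\<^sup>2)
         * hardy_partial (fps_expansion F 0 * inverse (1 - fps_const (cnj a) * fps_X)) N"
    show "?K \<le> C * exp (- (ln (1 / (1 - cmod l)) powr \<gamma>))"
      unfolding x_def[symmetric]
    proof (cases "x < x0")
      case True
      have "?K \<le> 1" by (rule hardy_partial_cauchy_kernel_le_1[OF F F1 reg(1)])
      also have "\<dots> \<le> C * exp (- (x powr \<gamma>))" using True reg by (intro small) auto
      finally show "?K \<le> C * exp (- (x powr \<gamma>))" .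
    next
      case False
      note dec = x0[of x]
      have "?K \<le> exp (- (x powr \<gamma>)) + 4 / (exp (- x / 4))\<^sup>2 * (1 - (cmod a)\<^sup>2)"
      proof (rule hardy_partial_cauchy_kernel_near[OF F F1 near[folded x_def] reg(1)])
        show "cmod (a - cis (Arg l)) \<le> exp (- x / 4) / 2" using reg dec False by linarith
      qed auto
      also have "4 / (exp (- x / 4))\<^sup>2 = 4 * exp (x / 2)"
        by (simp add: power2_eq_square exp_add[symmetric] exp_minus field_simps)
      also have "4 * exp (x / 2) * (1 - (cmod a)\<^sup>2) \<le> 4 * exp (x / 2) * (2 * (exp (- x) * x powr \<alpha>))"
        using reg by (intro mult_left_mono) auto
      also have "\<dots> = 8 * exp (x / 2) * (exp (- x) * x powr \<alpha>)" by simp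
      also have "\<dots> \<le> exp (- (x powr \<gamma>))" using dec False by auto
      finally have "?K \<le> 2 * exp (- (x powr \<gamma>))" by simp
      also have "\<dots> \<le> C * exp (- (x powr \<gamma>))" by (rule large)
      finally show "?K \<le> C * exp (- (x powr \<gamma>))" .
    qed
  qed
qed

text \<open>Within exp (-x/4) of the point the logarithm is at least x/4, and squaring the modulus
  doubles the exponent. The constant in \<open>c i\<close> is chosen to cancel the resulting factors
  4^(-s) and 2 * cos (s * pi / 2), leaving exactly x^(s-\<beta>).\<close>

lemma outer_fun_near_boundary_point:
  assumes s: "0 < s" "s < 1" and I: "finite I" "i \<in> I" and x: "0 < x"
    and c: "\<And>i. i \<in> I \<Longrightarrow> 0 \<le> c i" and unit: "\<And>i. i \<in> I \<Longrightarrow> cmod (\<zeta> i) = 1"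
    and ci: "c i = 4 powr s / (2 * cos (s * (pi / 2))) * (1 / x powr \<beta>)"
    and w: "cmod w < 1" "cmod (w - \<zeta> i) < exp (- x / 4)"
  shows "(cmod (outer_fun s c \<zeta> I w))\<^sup>2 \<le> exp (- (x powr (s - \<beta>)))"
proof -
  define \<kappa> where "\<kappa> = cos (s * (pi / 2))"
  define L where "L = cmod (boundary_log (\<zeta> i) w)"
  have \<kappa>: "0 < \<kappa>" using cos_half_pi_pos[OF s, of "{}" "\<lambda>_. 0" "\<lambda>_. 1"] by (simp add: \<kappa>_def)
  have pos: "0 < cmod (w - \<zeta> i)" using dist_unit_bounds[OF unit[OF I(2)] w(1)] by simp
  have "ln (cmod (w - \<zeta> i)) < - x / 4" using w(2) pos by (metis ln_exp ln_less_cancel_iff exp_gt_zero)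
  moreover have "0 \<le> ln (4::real)" by simp
  moreover have "ln (4 / cmod (w - \<zeta> i)) = ln 4 - ln (cmod (w - \<zeta> i))" using pos by (simp add: ln_div)
  ultimately have "x / 4 \<le> ln (4 / cmod (w - \<zeta> i))" by linarith
  hence "x / 4 \<le> L" using cmod_boundary_log_ge[OF unit[OF I(2)] w(1)] by (simp add: L_def)
  hence "(x / 4) powr s \<le> L powr s" using s x by (intro powr_mono2) auto
  hence "2 * \<kappa> * (c i * (x / 4) powr s) \<le> 2 * \<kappa> * (c i * L powr s)"
    using \<kappa> c[OF I(2)] by (intro mult_left_mono) auto
  moreover have "2 * \<kappa> * (c i * (x / 4) powr s) = x powr (s - \<beta>)"
    using \<kappa> x unfolding ci \<kappa>_def[symmetric] by (simp add: powr_divide powr_diff)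
  ultimately have le: "x powr (s - \<beta>) \<le> 2 * (\<kappa> * (c i * L powr s))" by simp
  have "(cmod (outer_fun s c \<zeta> I w))\<^sup>2 \<le> (exp (- (\<kappa> * (c i * L powr s))))\<^sup>2"
    unfolding \<kappa>_def L_def using s I c unit w
    by (intro power_mono cmod_outer_fun_le_term) auto
  also have "\<dots> = exp (- (2 * (\<kappa> * (c i * L powr s))))"
    by (simp add: power2_eq_square exp_add[symmetric])
  also have "\<dots> \<le> exp (- (x powr (s - \<beta>)))" using le by simp
  finally show ?thesis .
qed

text \<open>At distance at least 1/2 from every point the real part of the logarithm is at most ln
  8, and the imaginary part adds at most pi / 2. The bound depends on \<open>I\<close> only through
  \<open>S\<close>.\<close>

lemma cmod_outer_fun_lower_bound:
  assumes s: "0 < s" "s < 1" and I: "finite I"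
    and c: "\<And>i. i \<in> I \<Longrightarrow> 0 \<le> c i" and unit: "\<And>i. i \<in> I \<Longrightarrow> cmod (\<zeta> i) = 1"
    and z: "cmod z < 1 / 2" and S: "(\<Sum>i\<in>I. c i) \<le> S"
  shows "exp (- (S * (ln 8 + pi / 2) powr s)) \<le> cmod (outer_fun s c \<zeta> I z)"
proof -
  have z1: "cmod z < 1" using z by simp
  have "(\<Sum>i\<in>I. c i * cmod (boundary_log (\<zeta> i) z) powr s)
     \<le> (\<Sum>i\<in>I. c i * (ln 8 + pi / 2) powr s)"
  proof (intro sum_mono mult_left_mono c powr_mono2)
    fix i assume i: "i \<in> I"
    have "1 / 2 \<le> cmod (z - \<zeta> i)"
      using norm_triangle_ineq2[of "\<zeta> i" z] unit[OF i] z by (simp add: norm_minus_commute)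
    hence "4 / cmod (z - \<zeta> i) \<le> 8" by (simp add: divide_le_eq)
    hence "ln (4 / cmod (z - \<zeta> i)) \<le> ln 8"
      using dist_unit_bounds(1)[OF unit[OF i] z1] by (subst ln_le_cancel_iff) auto
    thus "cmod (boundary_log (\<zeta> i) z) \<le> ln 8 + pi / 2"
      using cmod_boundary_log_le[OF unit[OF i] z1] by linarith
  qed (use s in auto)
  also have "\<dots> \<le> S * (ln 8 + pi / 2) powr s"
    unfolding sum_distrib_right[symmetric] using S by (intro mult_right_mono) auto
  finally have "exp (- (S * (ln 8 + pi / 2) powr s))
     \<le> exp (- (\<Sum>i\<in>I. c i * cmod (boundary_log (\<zeta> i) z) powr s))" by simp
  also have "\<dots> \<le> cmod (outer_fun s c \<zeta> I z)"
    using cmod_outer_fun_ge[of s I c \<zeta>] s I c unit z1 by blast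
  finally show ?thesis .
qed

section \<open>Exhaustion of the family and construction of the function\<close>

text \<open>Because \<open>card\<close> is 0 on infinite sets, finiteness of each
  \<open>Z \<inter> \<Delta> l\<close> is stated separately; with cardinalities in the extended
  sense it follows from convergence of the sum, whose exponential weights are positive.\<close>

theorem theorem4p3:
  fixes \<alpha> \<beta> \<gamma> :: real
    and \<Lambda> Z :: "complex set"
    and \<Delta> :: "complex \<Rightarrow> complex set"
  assumes "0 < \<beta>" and "\<beta> < 1"
    and "\<Lambda> \<subseteq> ball 0 1 - {0}"
    and "(\<lambda>l. 1 / (ln (1 / (1 - cmod l))) powr \<beta>) summable_on \<Lambda>"
    and "0 < \<alpha>"
    and "0 < \<gamma>" and "\<gamma> < 1 - \<beta>"
    and "\<And>l. l \<in> \<Lambda> \<Longrightarrow> \<Delta> l \<subseteq> S_region l \<alpha>"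
    and "Z \<subseteq> (\<Union>l\<in>\<Lambda>. \<Delta> l)"
    and "\<And>l. l \<in> \<Lambda> \<Longrightarrow> finite (Z \<inter> \<Delta> l)"
    and "(\<lambda>l. real (card (Z \<inter> \<Delta> l)) * exp (- ((ln (1 / (1 - cmod l))) powr \<gamma>)))
           summable_on \<Lambda>"
  shows "dirichlet_zero_set Z"
proof -
  define x where "x l = ln (1 / (1 - cmod l))" for l :: complex
  define s where "s = \<beta> + \<gamma>"
  define \<kappa> where "\<kappa> = cos (s * (pi / 2))"
  define c where "c l = 4 powr s / (2 * \<kappa>) * (1 / x l powr \<beta>)" for l
  define \<zeta> where "\<zeta> l = cis (Arg l)" for l
  define e where "e l = exp (- (x l powr \<gamma>))" for l
  have s: "0 < s" "s < 1" and \<gamma>1: "\<gamma> < 1" using assms by (auto simp: s_def)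
  have \<kappa>: "0 < \<kappa>" using cos_half_pi_pos[OF s, of "{}" "\<lambda>_. 0" "\<lambda>_. 1"] by (simp add: \<kappa>_def)
  have x: "0 < x l" if "l \<in> \<Lambda>" for l
  proof -
    have "0 < cmod l" "cmod l < 1" using that assms(3) by auto
    thus ?thesis by (simp add: x_def field_simps)
  qed
  have c: "0 \<le> c l" for l using \<kappa> by (simp add: c_def)
  have unit: "cmod (\<zeta> l) = 1" for l by (simp add: \<zeta>_def)
  \<comment> \<open>A summable family has only countably many nonzero terms, and here every term is
    nonzero; the family can therefore be enumerated.\<close>
  have "countable {l \<in> \<Lambda>. 1 / x l powr \<beta> \<noteq> 0}"
    using summable_countable_real[OF assms(4)] by (simp add: x_def)
  also have "{l \<in> \<Lambda>. 1 / x l powr \<beta> \<noteq> 0} = \<Lambda>" using x by force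
  finally have count: "countable \<Lambda>" .
  have csum: "c summable_on \<Lambda>"
    unfolding c_def using assms(4) by (intro summable_on_cmult_right) (simp add: x_def)
  define Sc where "Sc = infsum c \<Lambda>"
  have Sc: "(\<Sum>l\<in>I. c l) \<le> Sc" if "finite I" "I \<subseteq> \<Lambda>" for I
    unfolding Sc_def using csum that c by (intro finite_sum_le_infsum) auto
  define Se where "Se = infsum (\<lambda>l. real (card (Z \<inter> \<Delta> l)) * e l) \<Lambda>"
  have Se: "(\<Sum>l\<in>I. real (card (Z \<inter> \<Delta> l)) * e l) \<le> Se" if "finite I" "I \<subseteq> \<Lambda>" for I
    unfolding Se_def e_def x_def using assms(11) that by (intro finite_sum_le_infsum) auto
  obtain C where C: "0 \<le> C"
    "\<And>l a. l \<in> ball 0 1 - {0} \<Longrightarrow> a \<in> S_region l \<alpha> \<Longrightarrow> 1 - (cmod a)\<^sup>2 \<le> C * e l"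
    "\<And>l a F N. l \<in> ball 0 1 - {0} \<Longrightarrow> a \<in> S_region l \<alpha> \<Longrightarrow> F holomorphic_on ball 0 1 \<Longrightarrow>
       (\<And>w. cmod w < 1 \<Longrightarrow> cmod (F w) \<le> 1) \<Longrightarrow>
       (\<And>w. cmod w < 1 \<Longrightarrow> cmod (w - \<zeta> l) < exp (- x l / 4) \<Longrightarrow> (cmod (F w))\<^sup>2 \<le> e l) \<Longrightarrow>
       (1 - (cmod a)\<^sup>2)
         * hardy_partial (fps_expansion F 0 * inverse (1 - fps_const (cnj a) * fps_X)) N \<le> C * e l"
    unfolding e_def x_def \<zeta>_def using S_region_estimate[OF assms(6) \<gamma>1, of \<alpha>] by blast
  define I where "I n = {l \<in> \<Lambda>. to_nat_on \<Lambda> l < n}" for n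
  define A where "A n = (\<Union>l\<in>I n. Z \<inter> \<Delta> l)" for n
  define F where "F n = outer_fun s c \<zeta> (I n)" for n
  have I: "finite (I n)" "I n \<subseteq> \<Lambda>" for n
  proof -
    have "inj_on (to_nat_on \<Lambda>) (I n)"
      using inj_on_to_nat_on[OF count] by (rule inj_on_subset) (auto simp: I_def)
    moreover have "to_nat_on \<Lambda> ` I n \<subseteq> {..<n}" by (auto simp: I_def)
    ultimately show "finite (I n)" by (meson finite_imageD finite_lessThan finite_subset)
  qed (auto simp: I_def)
  have disk: "l \<in> ball 0 1 - {0}" if "l \<in> \<Lambda>" for l using that assms(3) by auto
  have Zdisk: "Z \<subseteq> ball 0 1" using assms(8,9) by (fastforce simp: S_region_def)
  have A: "finite (A n)" "A n \<subseteq> ball 0 1" for n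
    unfolding A_def using I[of n] assms(10) Zdisk by (auto intro!: finite_UN_I simp del: UN_simps)
  have A_mem: "a \<in> S_region l \<alpha>" if "l \<in> I n" "a \<in> Z \<inter> \<Delta> l" for a l n
    using that I assms(8) by blast
  have card_sum: "(\<Sum>l\<in>I n. real (card (Z \<inter> \<Delta> l)) * (C * e l)) \<le> C * Se" for n
  proof -
    have "(\<Sum>l\<in>I n. real (card (Z \<inter> \<Delta> l)) * (C * e l)) = C * (\<Sum>l\<in>I n. real (card (Z \<inter> \<Delta> l)) * e l)"
      by (simp add: sum_distrib_left mult_ac)
    also have "\<dots> \<le> C * Se" by (intro mult_left_mono Se I C)
    finally show ?thesis .
  qed
  have one_minus: "0 \<le> 1 - (cmod a)\<^sup>2" if "a \<in> Z" for a
    using that Zdisk by (auto simp: power_le_one less_imp_le)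
  have blaschke: "(\<Sum>a\<in>A n. 1 - (cmod a)\<^sup>2) \<le> C * Se" for n
  proof -
    have "(\<Sum>a\<in>A n. 1 - (cmod a)\<^sup>2) \<le> (\<Sum>l\<in>I n. real (card (Z \<inter> \<Delta> l)) * (C * e l))"
      unfolding A_def using I assms(10) one_minus A_mem C(2) disk
      by (intro sum_UN_le_card) blast+
    with card_sum[of n] show ?thesis by linarith
  qed
  have A_exhaust: "\<forall>\<^sub>F n in sequentially. a \<in> A n" if a: "a \<in> Z" for a
  proof -
    obtain l where "l \<in> \<Lambda>" "a \<in> \<Delta> l" using a assms(9) by blast
    thus ?thesis using a
      \<comment> \<open>The inequality defining \<open>I n\<close> is strict, so the point numbered
        k enters at stage k + 1.\<close>
      by (intro eventually_sequentiallyI[of "Suc (to_nat_on \<Lambda> l)"]) (auto simp: A_def I_def)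
  qed
  have Fhol: "F n holomorphic_on ball 0 1" for n
    unfolding F_def using s I c unit by (intro holomorphic_outer_fun) auto
  have F1: "cmod (F n w) \<le> 1" if "cmod w < 1" for n w
    unfolding F_def using s I c unit that by (intro cmod_outer_fun_le_1) auto
  have kernel: "(\<Sum>a\<in>A n. (1 - (cmod a)\<^sup>2)
      * hardy_partial (fps_expansion (F n) 0 * inverse (1 - fps_const (cnj a) * fps_X)) N) \<le> C * Se"
    for n N
  proof -
    let ?K = "\<lambda>a. (1 - (cmod a)\<^sup>2)
      * hardy_partial (fps_expansion (F n) 0 * inverse (1 - fps_const (cnj a) * fps_X)) N"
    have "(\<Sum>a\<in>A n. ?K a) \<le> (\<Sum>l\<in>I n. real (card (Z \<inter> \<Delta> l)) * (C * e l))"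
      unfolding A_def
    proof (rule sum_UN_le_card)
      fix l a assume l: "l \<in> I n" and a: "a \<in> Z \<inter> \<Delta> l"
      show "0 \<le> ?K a"
        using a one_minus by (intro mult_nonneg_nonneg) (auto simp: hardy_partial_def sum_nonneg)
      have l\<Lambda>: "l \<in> \<Lambda>" using l I by blast
      show "?K a \<le> C * e l"
      proof (rule C(3)[OF disk[OF l\<Lambda>] A_mem[OF l a] Fhol F1])
        fix w assume "cmod w < 1" "cmod (w - \<zeta> l) < exp (- x l / 4)"
        hence "(cmod (F n w))\<^sup>2 \<le> exp (- (x l powr (s - \<beta>)))"
          unfolding F_def using s I l x[OF l\<Lambda>] c unit
          by (intro outer_fun_near_boundary_point) (auto simp: c_def \<kappa>_def)
        thus "(cmod (F n w))\<^sup>2 \<le> e l" by (simp add: e_def s_def)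
      qed
    qed (use I assms(10) in auto)
    with card_sum[of n] show ?thesis by linarith
  qed
  obtain D where D: "0 \<le> D"
    "\<And>(I :: complex set) c \<zeta>. finite I \<Longrightarrow> (\<And>i. i \<in> I \<Longrightarrow> 0 \<le> c i) \<Longrightarrow>
      (\<And>i. i \<in> I \<Longrightarrow> cmod (\<zeta> i) = 1) \<Longrightarrow>
      (\<integral>\<^sup>+ z. ennreal ((cmod (deriv (outer_fun s c \<zeta> I) z))\<^sup>2) \<partial>disk_area_measure)
          \<le> ennreal (D * (\<Sum>i\<in>I. c i))"
    using outer_fun_dirichlet_bound[OF s, where 'i = complex] by blast
  have Sc0: "0 \<le> Sc" using Sc[of "{}"] by simp
  have energy: "(\<integral>\<^sup>+ z. ennreal ((cmod (deriv (F n) z))\<^sup>2) \<partial>disk_area_measure) \<le> ennreal (D * Sc)" for n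
  proof -
    have "(\<integral>\<^sup>+ z. ennreal ((cmod (deriv (F n) z))\<^sup>2) \<partial>disk_area_measure) \<le> ennreal (D * (\<Sum>l\<in>I n. c l))"
      unfolding F_def using I c unit by (intro D) auto
    also have "\<dots> \<le> ennreal (D * Sc)" by (intro ennreal_leI mult_left_mono Sc I D)
    finally show ?thesis .
  qed
  \<comment> \<open>Any finite subset of \<open>Z\<close> lies in some \<open>A n\<close>, so the
    bound holds for all of \<open>Z\<close> and one point \<open>z0\<close> can be chosen
    independently of n.\<close>
  have finite_blaschke: "(\<Sum>a\<in>B. 1 - (cmod a)\<^sup>2) \<le> C * Se" if "finite B" "B \<subseteq> Z" for B
  proof -
    have "\<forall>\<^sub>F n in sequentially. \<forall>a\<in>B. a \<in> A n"
      using that A_exhaust by (intro eventually_ball_finite) auto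
    then obtain n where "B \<subseteq> A n" by (auto simp: eventually_sequentially)
    hence "(\<Sum>a\<in>B. 1 - (cmod a)\<^sup>2) \<le> (\<Sum>a\<in>A n. 1 - (cmod a)\<^sup>2)"
      using A one_minus by (intro sum_mono2) (auto simp: A_def)
    with blaschke[of n] show ?thesis by linarith
  qed
  obtain z0 r where z0: "cmod z0 < 1 / 2" and r: "0 < r" and far: "\<And>a. a \<in> Z \<Longrightarrow> r \<le> cmod (z0 - a)"
    using exists_point_far_from_blaschke_set[OF finite_blaschke] by blast
  \<comment> \<open>The lower bounds for the outer function and for the Blaschke product at
    \<open>z0\<close>; the root appears because the latter is proved for the squared
    modulus.\<close>
  define m where "m = exp (- (Sc * (ln 8 + pi / 2) powr s)) * sqrt (exp (- (C * Se) / r\<^sup>2))"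
  show ?thesis
  proof (rule dirichlet_zero_setI)
    show "Z \<subseteq> ball 0 1" by (rule Zdisk)
    show "(\<lambda>z. F n z * blaschke_prod (A n) z) holomorphic_on ball 0 1" for n
      by (intro holomorphic_intros Fhol A)
    show "cmod (F n z * blaschke_prod (A n) z) \<le> 1" if "cmod z < 1" for n z
      using mult_mono[OF F1[OF that] cmod_blaschke_prod_le_1[OF A(2) that]] by (simp add: norm_mult)
    show "(\<integral>\<^sup>+ z. ennreal ((cmod (deriv (\<lambda>z. F n z * blaschke_prod (A n) z) z))\<^sup>2) \<partial>disk_area_measure)
        \<le> ennreal (D * Sc + C * Se)" for n
      by (intro nn_integral_deriv_blaschke_le Fhol A energy kernel mult_nonneg_nonneg D Sc0)
    show "\<forall>\<^sub>F n in sequentially. F n a * blaschke_prod (A n) a = 0" if "a \<in> Z" for a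
      using A_exhaust[OF that] by eventually_elim (use A in \<open>auto simp: blaschke_prod_def\<close>)
    show "cmod z0 < 1" using z0 by simp
    show "0 < m" by (simp add: m_def)
    show "m \<le> cmod (F n z0 * blaschke_prod (A n) z0)" for n
      unfolding m_def norm_mult
    proof (intro mult_mono)
      show "exp (- (Sc * (ln 8 + pi / 2) powr s)) \<le> cmod (F n z0)"
        unfolding F_def using s I c unit z0 Sc[OF I] by (intro cmod_outer_fun_lower_bound) auto
      have "exp (- (C * Se) / r\<^sup>2) \<le> exp (- (\<Sum>a\<in>A n. 1 - (cmod a)\<^sup>2) / r\<^sup>2)"
        using blaschke[of n] r by (simp add: divide_right_mono)
      also have "\<dots> \<le> (cmod (blaschke_prod (A n) z0))\<^sup>2"
        using z0 r far by (intro cmod_blaschke_prod_ge A) (auto simp: A_def)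
      finally show "sqrt (exp (- (C * Se) / r\<^sup>2)) \<le> cmod (blaschke_prod (A n) z0)"
        by (rule real_le_lsqrt[rotated -1]) auto
    qed auto
  qed
qed

end
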